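(* For every integer $n\geq 1$ and every integer $k\geq 3$, there exists an $n$-vertex outerpath $G$ with the following property: for every set $\mathcal I\subseteq V(G)$ such that the induced subgraph $G[\mathcal I]$ has maximum degree at most $k$, we have $|\mathcal I|\leq \frac{k-1}{k}n+2$.
   Context: Graphs are finite and simple. For $\mathcal I\subseteq V(G)$, $G[\mathcal I]$ is the subgraph induced by $\mathcal I$; the degree of a graph is its maximum vertex degree. An outerplanar graph is a graph admitting a planar drawing with all vertices on the outer face; it is maximal outerplanar if no edge can be added keeping it simple and outerplanar. A maximal outerplanar graph has an essentially unique outerplanar embedding whose internal faces are triangles; its weak dual is the graph with one vertex per internal face, two being adjacent when the faces share an edge. A maximal outerpath is a maximal outerplanar graph whose weak dual is a path, and an outerpath is a subgraph of a maximal outerpath. *)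

theory Defs
  imports "HOL-Analysis.Analysis"
begin

text \<open>A graph is given by its vertex set \<open>V\<close> and its edge set \<open>E\<close>, where an edge is the
  two-element set of its endpoints.\<close>

definition simple_graph :: "'a set \<Rightarrow> 'a set set \<Rightarrow> bool" where
  "simple_graph V E \<longleftrightarrow> finite V \<and> (\<forall>e\<in>E. e \<subseteq> V \<and> card e = 2)"

definition is_subgraph :: "'a set \<Rightarrow> 'a set set \<Rightarrow> 'a set \<Rightarrow> 'a set set \<Rightarrow> bool" where
  "is_subgraph V E V' E' \<longleftrightarrow> simple_graph V E \<and> simple_graph V' E' \<and> V \<subseteq> V' \<and> E \<subseteq> E'"

definition induced_edges :: "'a set set \<Rightarrow> 'a set \<Rightarrow> 'a set set" where
  "induced_edges E I = {e\<in>E. e \<subseteq> I}"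

definition vertex_degree :: "'a set set \<Rightarrow> 'a \<Rightarrow> nat" where
  "vertex_degree E v = card {e\<in>E. v \<in> e}"

text \<open>The inserted \<open>0\<close> only matters for the graph without vertices.\<close>

definition max_degree :: "'a set \<Rightarrow> 'a set set \<Rightarrow> nat" where
  "max_degree V E = Max (insert 0 (vertex_degree E ` V))"

definition path_graph :: "'a set \<Rightarrow> 'a set set \<Rightarrow> bool" where
  "path_graph V E \<longleftrightarrow>
     (\<exists>xs. xs \<noteq> [] \<and> distinct xs \<and> V = set xs \<and>
           E = {{xs ! i, xs ! Suc i} | i. Suc i < length xs})"

text \<open>The plane is \<^typ>\<open>complex\<close>. A drawing places a vertex \<open>v\<close> at the point \<open>p v\<close> and draws an
  edge \<open>e\<close> as the simple arc \<open>\<gamma> e\<close>; arcs meet vertices and other arcs only at common endpoints.\<close>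

definition planar_drawing ::
    "'a set \<Rightarrow> 'a set set \<Rightarrow> ('a \<Rightarrow> complex) \<Rightarrow> ('a set \<Rightarrow> real \<Rightarrow> complex) \<Rightarrow> bool" where
  "planar_drawing V E p \<gamma> \<longleftrightarrow>
     inj_on p V \<and>
     (\<forall>e\<in>E. arc (\<gamma> e) \<and> {pathstart (\<gamma> e), pathfinish (\<gamma> e)} = p ` e) \<and>
     (\<forall>e\<in>E. path_image (\<gamma> e) \<inter> p ` V = p ` e) \<and>
     (\<forall>e\<in>E. \<forall>f\<in>E. e \<noteq> f \<longrightarrow> path_image (\<gamma> e) \<inter> path_image (\<gamma> f) \<subseteq> p ` (e \<inter> f))"

definition drawing_image ::
    "'a set \<Rightarrow> 'a set set \<Rightarrow> ('a \<Rightarrow> complex) \<Rightarrow> ('a set \<Rightarrow> real \<Rightarrow> complex) \<Rightarrow> complex set" where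
  "drawing_image V E p \<gamma> = p ` V \<union> (\<Union>e\<in>E. path_image (\<gamma> e))"

text \<open>Faces are the connected components of the complement of the drawing. As the drawing is
  compact, its \<^const>\<open>outside\<close> is the unique unbounded one.\<close>

definition internal_faces ::
    "'a set \<Rightarrow> 'a set set \<Rightarrow> ('a \<Rightarrow> complex) \<Rightarrow> ('a set \<Rightarrow> real \<Rightarrow> complex) \<Rightarrow> complex set set" where
  "internal_faces V E p \<gamma> = {F \<in> components (- drawing_image V E p \<gamma>). bounded F}"

definition outerplanar_drawing ::
    "'a set \<Rightarrow> 'a set set \<Rightarrow> ('a \<Rightarrow> complex) \<Rightarrow> ('a set \<Rightarrow> real \<Rightarrow> complex) \<Rightarrow> bool" where
  "outerplanar_drawing V E p \<gamma> \<longleftrightarrow>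
     planar_drawing V E p \<gamma> \<and> p ` V \<subseteq> frontier (outside (drawing_image V E p \<gamma>))"

definition outerplanar :: "'a set \<Rightarrow> 'a set set \<Rightarrow> bool" where
  "outerplanar V E \<longleftrightarrow> simple_graph V E \<and> (\<exists>p \<gamma>. outerplanar_drawing V E p \<gamma>)"

definition maximal_outerplanar :: "'a set \<Rightarrow> 'a set set \<Rightarrow> bool" where
  "maximal_outerplanar V E \<longleftrightarrow>
     outerplanar V E \<and>
     (\<forall>u\<in>V. \<forall>v\<in>V. u \<noteq> v \<and> {u, v} \<notin> E \<longrightarrow> \<not> outerplanar V (insert {u, v} E))"

text \<open>The weak dual has vertex set \<^const>\<open>internal_faces\<close> and the following edges.\<close>

definition weak_dual_edges ::
    "'a set \<Rightarrow> 'a set set \<Rightarrow> ('a \<Rightarrow> complex) \<Rightarrow> ('a set \<Rightarrow> real \<Rightarrow> complex) \<Rightarrow> complex set set set" where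
  "weak_dual_edges V E p \<gamma> =
     {{F, F'} | F F'. F \<in> internal_faces V E p \<gamma> \<and> F' \<in> internal_faces V E p \<gamma> \<and> F \<noteq> F' \<and>
        (\<exists>e\<in>E. path_image (\<gamma> e) \<subseteq> frontier F \<inter> frontier F')}"

text \<open>The outerplanar embedding of a maximal outerplanar graph is essentially unique, so it does
  not matter which outerplanar drawing is used to form the weak dual. Since \<^const>\<open>path_graph\<close>
  requires at least one vertex, a maximal outerpath has at least one internal face; the maximal
  outerplanar graphs with fewer than three vertices are still outerpaths, being subgraphs of a
  triangle (provided the type of vertices is large enough).\<close>

definition maximal_outerpath :: "'a set \<Rightarrow> 'a set set \<Rightarrow> bool" where
  "maximal_outerpath V E \<longleftrightarrow>
     maximal_outerplanar V E \<and>
     (\<exists>p \<gamma>. outerplanar_drawing V E p \<gamma> \<and>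
            path_graph (internal_faces V E p \<gamma>) (weak_dual_edges V E p \<gamma>))"

definition outerpath :: "'a set \<Rightarrow> 'a set set \<Rightarrow> bool" where
  "outerpath V E \<longleftrightarrow> (\<exists>V' E'. maximal_outerpath V' E' \<and> is_subgraph V E V' E')"

end

theory Submission
  imports Defs
begin

text \<open>The vertices are \<open>0, \<dots>, n - 1\<close>; the multiples of \<open>k\<close> are hubs, and each hub \<open>h\<close> is adjacent to
  \<open>h - 1\<close> and to \<open>h + 1, \<dots>, h + k + 1\<close>, hence also to \<open>h - k\<close>. A block consists of a hub and the
  \<open>k - 1\<close> leaves after it. If a block loses no vertex, at most one of the four outer neighbours
  \<open>h - k\<close>, \<open>h - 1\<close>, \<open>h + k\<close>, \<open>h + k + 1\<close> of its hub survives, so an adjacent block loses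
  its hub and the leaf that faces the intact block, and this leaf pays for the intact block.

  The graph lies in a triangulated strip: put all vertices on two horizontal lines such that each
  new vertex \<open>j + 2\<close> forms a triangle with the latest vertices on the two lines. If \<open>u\<close> is one of the
  vertices before \<open>j + 2\<close>, but not one of these two, then an edge from \<open>u\<close> to \<open>j + 2\<close>
  creates a subdivision of \<open>K\<^sub>4\<close>, which has no drawing with its four branch vertices on the outer
  face. The latter follows from the fact that, of three arcs that meet only in their common endpoints, one
  runs inside the curve formed by the other two.\<close>

section \<open>Arcs with common endpoints\<close>

text \<open>If \<open>c3\<close> stays out of the region \<open>A\<close> bounded by
  \<open>c1\<close> and \<open>c2\<close>, then \<open>A\<close>, being connected, lies entirely
  inside the curve formed by \<open>c3\<close> and one of \<open>c1\<close>, \<open>c2\<close>.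
  Taking closures encloses the frontier of \<open>A\<close> as well, hence the remaining arc up to
  its ends.\<close>

lemma theta_curve_inside:
  fixes c1 c2 c3 :: "real \<Rightarrow> complex"
  assumes "arc c1" "pathstart c1 = a" "pathfinish c1 = b"
    and "arc c2" "pathstart c2 = a" "pathfinish c2 = b"
    and "arc c3" "pathstart c3 = a" "pathfinish c3 = b"
    and i12: "path_image c1 \<inter> path_image c2 = {a, b}"
    and i13: "path_image c1 \<inter> path_image c3 = {a, b}"
    and i23: "path_image c2 \<inter> path_image c3 = {a, b}"
  shows "path_image c3 \<inter> inside (path_image c1 \<union> path_image c2) \<noteq> {} \<or>
         path_image c2 - {a, b} \<subseteq> inside (path_image c1 \<union> path_image c3) \<or>
         path_image c1 - {a, b} \<subseteq> inside (path_image c2 \<union> path_image c3)"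
proof -
  define A where "A = inside (path_image c1 \<union> path_image c2)"
  define B where "B = inside (path_image c1 \<union> path_image c3)"
  define C where "C = inside (path_image c2 \<union> path_image c3)"
  have cl: "closed (path_image c1)" "closed (path_image c2)" "closed (path_image c3)"
    and cp: "compact (path_image c1)" "compact (path_image c2)" "compact (path_image c3)"
    using assms by (auto simp: closed_arc_image compact_arc_image)
  have loop: "simple_path (c1 +++ reversepath c2)" "pathfinish (c1 +++ reversepath c2) = pathstart (c1 +++ reversepath c2)"
    using assms by (auto intro!: simple_path_join_loop arc_reversepath)
  have img: "path_image (c1 +++ reversepath c2) = path_image c1 \<union> path_image c2"
    using assms by (subst path_image_join) auto
  have J: "connected A" "A \<noteq> {}" "frontier A = path_image c1 \<union> path_image c2"
    using Jordan_inside_outside[OF loop] unfolding img A_def by auto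
  have open_BC: "open B" "open C"
    unfolding B_def C_def using cl by (auto intro: open_inside)
  \<comment> \<open>Janiszewski's theorem for two of the three closed curves, which share the connected set \<open>c3\<close>\<close>
  have pieces: "p \<in> B \<union> C" if p: "p \<in> A" "p \<notin> path_image c3" for p
  proof (rule ccontr)
    assume np: "p \<notin> B \<union> C"
    have p12: "p \<notin> path_image c1" "p \<notin> path_image c2"
      using p(1) inside_no_overlap[of "path_image c1 \<union> path_image c2"] unfolding A_def by blast+
    have out: "p \<in> outside (path_image c1 \<union> path_image c3)" "p \<in> outside (path_image c2 \<union> path_image c3)"
      using np p12 p(2) union_with_inside[of "path_image c1 \<union> path_image c3"]
        inside_Un_outside[of "path_image c1 \<union> path_image c3"]
        inside_Un_outside[of "path_image c2 \<union> path_image c3"]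
      unfolding B_def C_def by blast+
    have bdd: "bounded (path_image c1 \<union> path_image c2 \<union> path_image c3)"
      using cp by (simp add: compact_imp_bounded)
    then have "outside (path_image c1 \<union> path_image c2 \<union> path_image c3) \<noteq> {}"
      by (rule outside_bounded_nonempty)
    \<comment> \<open>\<open>q\<close> acts as a point at infinity: it lies outside each of the
      three closed curves, so a point outside one of them can be joined to \<open>q\<close> in the
      complement of that curve.\<close>
    then obtain q where q: "q \<in> outside (path_image c1 \<union> path_image c2 \<union> path_image c3)" by blast
    have conn: "connected_component (- T) p q"
      if "T \<subseteq> path_image c1 \<union> path_image c2 \<union> path_image c3" "p \<in> outside T" for T
    proof -
      have "q \<in> outside T" using q outside_mono[OF that(1)] by blast
      moreover have "connected (outside T)"
        using bounded_subset[OF bdd that(1)] by (intro connected_outside) auto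
      moreover have "outside T \<subseteq> - T" using outside_no_overlap[of T] by blast
      ultimately show ?thesis
        using that(2) unfolding connected_component_def by blast
    qed
    have int: "(path_image c1 \<union> path_image c3) \<inter> (path_image c2 \<union> path_image c3) = path_image c3"
      using i12 i13 i23 by auto
    have "connected (path_image c3)"
      using \<open>arc c3\<close> by (simp add: connected_arc_image)
    then have "connected_component (- ((path_image c1 \<union> path_image c3) \<union> (path_image c2 \<union> path_image c3))) p q"
      using out cl cp by (intro Janiszewski conn) (auto simp: int)
    then have "connected_component (- (path_image c1 \<union> path_image c2)) q p"
      by (rule connected_component_sym[OF connected_component_of_subset]) auto
    moreover have "q \<in> outside (path_image c1 \<union> path_image c2)"
      using q outside_mono[of "path_image c1 \<union> path_image c2" "path_image c1 \<union> path_image c2 \<union> path_image c3"]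
      by blast
    ultimately have "p \<in> outside (path_image c1 \<union> path_image c2)"
      by (rule outside_same_component)
    then show False
      using p(1) inside_Int_outside[of "path_image c1 \<union> path_image c2"] unfolding A_def by blast
  qed
  show ?thesis
  proof (cases "path_image c3 \<inter> A = {}")
    case False
    then show ?thesis unfolding A_def by blast
  next
    case True
    have noA: "A \<inter> (path_image c1 \<union> path_image c2) = {}"
      using inside_no_overlap[of "path_image c1 \<union> path_image c2"] unfolding A_def by blast
    have sub: "A \<subseteq> B \<union> C" using pieces True by blast
    have cons: "A \<subseteq> inside T" if AT: "A \<inter> T = {}" "A \<inter> inside T \<noteq> {}" for T
    proof
      fix w assume w: "w \<in> A"
      obtain z where z: "z \<in> A" "z \<in> inside T" using AT(2) by blast
      have "A \<subseteq> - T" using AT(1) by blast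
      then have "connected_component (- T) z w"
        using J(1) z(1) w unfolding connected_component_def by blast
      then show "w \<in> inside T" using z(2) by (rule inside_same_component)
    qed
    have cls: "path_image c1 \<union> path_image c2 \<subseteq> T \<union> inside T" if "A \<subseteq> inside T" "closed T" for T
    proof -
      have "closure A \<subseteq> closure (inside T)" using that by (intro closure_mono)
      also have "\<dots> \<subseteq> T \<union> inside T" using that(2) by (rule closure_inside_subset)
      finally show ?thesis using J(3) unfolding frontier_def by blast
    qed
    consider "A \<inter> B \<noteq> {}" | "A \<inter> C \<noteq> {}" using sub J(2) by blast
    then show ?thesis
    proof cases
      case 1
      then have "A \<subseteq> B" unfolding B_def using noA True by (intro cons) auto
      then have "path_image c1 \<union> path_image c2 \<subseteq> (path_image c1 \<union> path_image c3) \<union> B"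
        unfolding B_def using cl by (intro cls) auto
      then have "path_image c2 - {a, b} \<subseteq> B" using i12 i23 by blast
      then show ?thesis unfolding B_def by blast
    next
      case 2
      then have "A \<subseteq> C" unfolding C_def using noA True by (intro cons) auto
      then have "path_image c1 \<union> path_image c2 \<subseteq> (path_image c2 \<union> path_image c3) \<union> C"
        unfolding C_def using cl by (intro cls) auto
      then have "path_image c1 - {a, b} \<subseteq> C" using i12 i13 by blast
      then show ?thesis unfolding C_def by blast
    qed
  qed
qed

text \<open>\<open>inside T\<close> is open and disjoint from \<open>outside T\<close>, which
  contains \<open>outside S\<close>; so none of its points is a limit of points of
  \<open>outside S\<close>.\<close>

lemma frontier_outside_not_inside:
  fixes S T :: "'a::real_normed_vector set"
  assumes "x \<in> frontier (outside S)" "T \<subseteq> S" "closed T"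
  shows "x \<notin> inside T"
proof
  assume "x \<in> inside T"
  moreover have "x \<in> closure (outside S)" using assms(1) by (simp add: frontier_def)
  ultimately have "inside T \<inter> outside S \<noteq> {}"
    using open_inside[OF assms(3)] by (metis open_Int_closure_eq_empty disjoint_iff)
  then show False using outside_mono[OF assms(2)] inside_Int_outside[of T] by blast
qed

text \<open>An exposed point cannot be enclosed, so \<open>x2\<close> and \<open>x1\<close>
  eliminate the second and the third alternative of \<open>theta_curve_inside\<close>.\<close>

lemma exposed_theta_curve:
  fixes c1 c2 c3 :: "real \<Rightarrow> complex"
  assumes "arc c1" "pathstart c1 = a" "pathfinish c1 = b"
    and "arc c2" "pathstart c2 = a" "pathfinish c2 = b"
    and "arc c3" "pathstart c3 = a" "pathfinish c3 = b"
    and "path_image c1 \<inter> path_image c2 = {a, b}"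
    and "path_image c1 \<inter> path_image c3 = {a, b}"
    and "path_image c2 \<inter> path_image c3 = {a, b}"
    and S: "path_image c1 \<union> path_image c2 \<union> path_image c3 \<subseteq> S"
    and x: "x1 \<in> path_image c1 - {a, b}" "x2 \<in> path_image c2 - {a, b}"
    and fr: "x1 \<in> frontier (outside S)" "x2 \<in> frontier (outside S)"
  shows "path_image c3 \<inter> inside (path_image c1 \<union> path_image c2) \<noteq> {}"
proof -
  have cl: "closed (path_image c1)" "closed (path_image c2)" "closed (path_image c3)"
    using assms by (auto simp: closed_arc_image)
  have "x2 \<notin> inside (path_image c1 \<union> path_image c3)" "x1 \<notin> inside (path_image c2 \<union> path_image c3)"
    using frontier_outside_not_inside[OF fr(2), of "path_image c1 \<union> path_image c3"]
      frontier_outside_not_inside[OF fr(1), of "path_image c2 \<union> path_image c3"] cl S by auto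
  then show ?thesis
    using theta_curve_inside[OF assms(1-12)] x by blast
qed

text \<open>The arcs form a subdivision of K4: a closed curve through \<open>x\<close>,
  \<open>u\<close>, \<open>y\<close>, \<open>v\<close> in this order, with chords \<open>c\<close>
  and \<open>d\<close>. As all four points are exposed, both chords enter the inside of the curve.
  There \<open>c\<close> separates \<open>u\<close> from \<open>v\<close>, so \<open>d\<close> would
  have to cross \<open>c\<close>.\<close>

lemma K4_not_exposed:
  fixes g1 g2 h1 h2 c d :: "real \<Rightarrow> complex"
  assumes g1: "arc g1" "pathstart g1 = x" "pathfinish g1 = u"
    and g2: "arc g2" "pathstart g2 = u" "pathfinish g2 = y"
    and h1: "arc h1" "pathstart h1 = x" "pathfinish h1 = v"
    and h2: "arc h2" "pathstart h2 = v" "pathfinish h2 = y"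
    and c: "arc c" "pathstart c = x" "pathfinish c = y"
    and d: "arc d" "pathstart d = u" "pathfinish d = v"
    and disj: "path_image g1 \<inter> path_image g2 \<subseteq> {u}" "path_image h1 \<inter> path_image h2 \<subseteq> {v}"
      "path_image g1 \<inter> path_image h1 \<subseteq> {x}" "path_image g2 \<inter> path_image h2 \<subseteq> {y}"
      "path_image g1 \<inter> path_image h2 = {}" "path_image g2 \<inter> path_image h1 = {}"
      "path_image c \<inter> path_image g1 \<subseteq> {x}" "path_image c \<inter> path_image h1 \<subseteq> {x}"
      "path_image c \<inter> path_image g2 \<subseteq> {y}" "path_image c \<inter> path_image h2 \<subseteq> {y}"
      "path_image d \<inter> path_image g1 \<subseteq> {u}" "path_image d \<inter> path_image g2 \<subseteq> {u}"
      "path_image d \<inter> path_image h1 \<subseteq> {v}" "path_image d \<inter> path_image h2 \<subseteq> {v}"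
      "path_image c \<inter> path_image d = {}"
    and S: "path_image g1 \<union> path_image g2 \<union> path_image h1 \<union> path_image h2 \<union>
            path_image c \<union> path_image d \<subseteq> S"
  shows "\<not> {x, y, u, v} \<subseteq> frontier (outside S)"
proof
  assume fr: "{x, y, u, v} \<subseteq> frontier (outside S)"
  have ends: "x \<in> path_image g1" "u \<in> path_image g1" "u \<in> path_image g2" "y \<in> path_image g2"
    "x \<in> path_image h1" "v \<in> path_image h1" "v \<in> path_image h2" "y \<in> path_image h2"
    "x \<in> path_image c" "y \<in> path_image c" "u \<in> path_image d" "v \<in> path_image d"
    using g1 g2 h1 h2 c d by (metis pathstart_in_path_image pathfinish_in_path_image)+
  have ne: "x \<noteq> u" "x \<noteq> y" "x \<noteq> v" "u \<noteq> y" "v \<noteq> y" "u \<noteq> v"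
    using g1 g2 h1 h2 c d by (metis arc_distinct_ends)+
  \<comment> \<open>\<open>G\<close> and \<open>H\<close> split the closed curve at \<open>x\<close>
    and \<open>y\<close>, the ends of \<open>c\<close>; \<open>G'\<close> and \<open>H'\<close>
    split the same curve at \<open>u\<close> and \<open>v\<close>, the ends of
    \<open>d\<close>.\<close>
  define G where "G = g1 +++ g2"
  define H where "H = h1 +++ h2"
  define G' where "G' = reversepath g1 +++ h1"
  define H' where "H' = g2 +++ reversepath h2"
  have G: "arc G" "pathstart G = x" "pathfinish G = y" "path_image G = path_image g1 \<union> path_image g2"
    unfolding G_def using g1 g2 disj by (auto intro!: arc_join simp: path_image_join)
  have H: "arc H" "pathstart H = x" "pathfinish H = y" "path_image H = path_image h1 \<union> path_image h2"
    unfolding H_def using h1 h2 disj by (auto intro!: arc_join simp: path_image_join)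
  have G': "arc G'" "pathstart G' = u" "pathfinish G' = v" "path_image G' = path_image g1 \<union> path_image h1"
    unfolding G'_def using g1 h1 disj by (auto intro!: arc_join arc_reversepath simp: path_image_join)
  have H': "arc H'" "pathstart H' = u" "pathfinish H' = v" "path_image H' = path_image g2 \<union> path_image h2"
    unfolding H'_def using g2 h2 disj by (auto intro!: arc_join arc_reversepath simp: path_image_join)
  have single: "A \<inter> B = {z} \<and> B \<inter> A = {z}" if "A \<inter> B \<subseteq> {z}" "z \<in> A" "z \<in> B"
    for A B :: "complex set" and z using that by blast
  note singles =
    single[OF disj(1) ends(2) ends(3)] single[OF disj(2) ends(6) ends(7)] single[OF disj(3) ends(1) ends(5)]
    single[OF disj(4) ends(4) ends(8)]
    single[OF disj(7) ends(9) ends(1)] single[OF disj(8) ends(9) ends(5)] single[OF disj(9) ends(10) ends(4)]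
    single[OF disj(10) ends(10) ends(8)] single[OF disj(11) ends(11) ends(2)] single[OF disj(12) ends(11) ends(3)]
    single[OF disj(13) ends(12) ends(6)] single[OF disj(14) ends(12) ends(7)]
    disj(5,6)
  have ints: "path_image G \<inter> path_image H = {x, y}" "path_image G \<inter> path_image c = {x, y}"
    "path_image H \<inter> path_image c = {x, y}"
    by (auto simp: G(4) H(4) Int_Un_distrib Int_Un_distrib2 singles Int_commute)
  have ints': "path_image G' \<inter> path_image H' = {u, v}" "path_image G' \<inter> path_image d = {u, v}"
    "path_image H' \<inter> path_image d = {u, v}"
    by (auto simp: G'(4) H'(4) Int_Un_distrib Int_Un_distrib2 singles Int_commute)
  have c_in: "path_image c \<inter> inside (path_image G \<union> path_image H) \<noteq> {}"
    by (rule exposed_theta_curve[OF G(1-3) H(1-3) c ints, of S u v])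
      (use S fr ne ends G(4) H(4) in auto)
  have "path_image d \<inter> inside (path_image G' \<union> path_image H') \<noteq> {}"
    by (rule exposed_theta_curve[OF G'(1-3) H'(1-3) d ints', of S x y])
      (use S fr ne ends G'(4) H'(4) in auto)
  moreover have eq: "path_image G' \<union> path_image H' = path_image G \<union> path_image H"
    unfolding G(4) H(4) G'(4) H'(4) by blast
  ultimately have d_in: "path_image d \<inter> inside (path_image G \<union> path_image H) \<noteq> {}" by simp
  obtain spl: "inside (path_image G \<union> path_image c) \<inter> inside (path_image H \<union> path_image c) = {}"
      "inside (path_image G \<union> path_image c) \<union> inside (path_image H \<union> path_image c) \<union>
           (path_image c - {x, y}) = inside (path_image G \<union> path_image H)"
    using split_inside_simple_closed_curve[OF arc_imp_simple_path[OF G(1)] G(2,3) arc_imp_simple_path[OF H(1)] H(2,3)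
        arc_imp_simple_path[OF c(1)] c(2,3) ne(2) ints c_in] by metis
  have conn: "connected (path_image d - {u, v})"
    using connected_simple_path_endless[OF arc_imp_simple_path[OF d(1)]] d by simp
  have cl_d: "path_image d \<subseteq> closure (path_image d - {u, v})"
  proof -
    have "path_image d - {u, v} = d ` {0<..<1}"
      using simple_path_endless[OF arc_imp_simple_path[OF d(1)]] d by simp
    moreover have "d ` closure {0<..<1} \<subseteq> closure (d ` {0<..<1})"
      using d(1) by (intro image_closure_subset) (auto simp: arc_def path_def closure_subset)
    ultimately show ?thesis by (simp add: path_image_def)
  qed
  \<comment> \<open>\<open>T\<close> will bound one of the two regions into which \<open>c\<close>
    cuts the inside. If \<open>d\<close> enters such a region, then it stays there between its ends,
    and its closure lies in \<open>T \<union> inside T\<close>. Exposed points are not inside, so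
    \<open>u\<close> and \<open>v\<close> would both lie on \<open>T\<close>, but \<open>T\<close>
    misses one of them.\<close>
  have key: False if d_in_T: "path_image d \<inter> inside T \<noteq> {}" and T: "closed T" "T \<subseteq> S"
    "T \<inter> (path_image d - {u, v}) = {}" "{u, v} - T \<noteq> {}" for T
  proof -
    obtain z where z: "z \<in> path_image d" "z \<in> inside T" using d_in_T by blast
    have uv: "u \<notin> inside T" "v \<notin> inside T"
      using fr T frontier_outside_not_inside[of _ S T] by blast+
    then have zd: "z \<in> path_image d - {u, v}" using z by blast
    have "path_image d - {u, v} \<subseteq> inside T"
    proof
      fix w assume w: "w \<in> path_image d - {u, v}"
      have "path_image d - {u, v} \<subseteq> - T" using T(3) by blast
      then have "connected_component (- T) z w"
        using conn zd w unfolding connected_component_def by blast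
      then show "w \<in> inside T" using z(2) by (rule inside_same_component)
    qed
    then have "closure (path_image d - {u, v}) \<subseteq> closure (inside T)"
      by (rule closure_mono)
    also have "\<dots> \<subseteq> T \<union> inside T" using T(1) by (rule closure_inside_subset)
    finally show False using cl_d ends uv T(4) by blast
  qed
  have cl: "closed (path_image G)" "closed (path_image H)" "closed (path_image c)"
    using closed_arc_image[OF G(1)] closed_arc_image[OF H(1)] closed_arc_image[OF c(1)] by auto
  have v: "v \<notin> path_image G \<union> path_image c"
    using disj(11,12,15) ends(12) ne(6) unfolding G(4) by blast
  have u: "u \<notin> path_image H \<union> path_image c"
    using disj(13,14,15) ends(11) ne(6) unfolding H(4) by blast
  have "path_image G \<inter> path_image d \<subseteq> {u}" "path_image H \<inter> path_image d \<subseteq> {v}"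
    using disj(11-14) unfolding G(4) H(4) by blast+
  then have off: "(path_image G \<union> path_image c) \<inter> (path_image d - {u, v}) = {}"
      "(path_image H \<union> path_image c) \<inter> (path_image d - {u, v}) = {}"
    using disj(15) by blast+
  have sub: "path_image G \<union> path_image c \<subseteq> S" "path_image H \<union> path_image c \<subseteq> S"
    using S unfolding G(4) H(4) by blast+
  have "path_image d \<inter> inside (path_image G \<union> path_image c) = {}"
    using key[OF _ closed_Un[OF cl(1,3)] sub(1) off(1)] v by blast
  moreover have "path_image d \<inter> inside (path_image H \<union> path_image c) = {}"
    using key[OF _ closed_Un[OF cl(2,3)] sub(2) off(2)] u by blast
  ultimately show False using d_in disj(15) unfolding spl(2)[symmetric] by blast
qed

text \<open>This is \<open>K4_not_exposed\<close> with \<open>g\<close> cut at \<open>u\<close>. In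
  the strip, \<open>g\<close> arises as one arc through all earlier vertices, with \<open>u\<close>
  somewhere on it; the injectivity of \<open>g\<close> keeps the two pieces apart except at
  \<open>u\<close>.\<close>

lemma crossing_chords_not_exposed:
  fixes g h1 h2 c d :: "real \<Rightarrow> complex"
  assumes g: "arc g" "pathstart g = x" "pathfinish g = y" "u \<in> path_image g" "u \<noteq> x" "u \<noteq> y"
    and h1: "arc h1" "pathstart h1 = x" "pathfinish h1 = v"
    and h2: "arc h2" "pathstart h2 = v" "pathfinish h2 = y"
    and c: "arc c" "pathstart c = x" "pathfinish c = y"
    and d: "arc d" "pathstart d = u" "pathfinish d = v"
    and disj: "path_image h1 \<inter> path_image h2 \<subseteq> {v}"
      "path_image g \<inter> path_image h1 \<subseteq> {x}" "path_image g \<inter> path_image h2 \<subseteq> {y}"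
      "path_image c \<inter> path_image g \<subseteq> {x, y}"
      "path_image c \<inter> path_image h1 \<subseteq> {x}" "path_image c \<inter> path_image h2 \<subseteq> {y}"
      "path_image d \<inter> path_image g \<subseteq> {u}"
      "path_image d \<inter> path_image h1 \<subseteq> {v}" "path_image d \<inter> path_image h2 \<subseteq> {v}"
      "path_image c \<inter> path_image d = {}"
    and S: "path_image g \<union> path_image h1 \<union> path_image h2 \<union> path_image c \<union> path_image d \<subseteq> S"
  shows "\<not> {x, y, u, v} \<subseteq> frontier (outside S)"
proof -
  obtain r where r: "r \<in> {0..1}" "u = g r" using g(4) by (auto simp: path_image_def)
  have r01: "r \<noteq> 0" "r \<noteq> 1"
    using r g by (auto simp: pathstart_def pathfinish_def)
  define g1 where "g1 = subpath 0 r g"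
  define g2 where "g2 = subpath r 1 g"
  have arcs: "arc g1" "arc g2"
    unfolding g1_def g2_def using g(1) r r01 by (auto intro!: arc_subpath_arc)
  have ends: "pathstart g1 = x" "pathfinish g1 = u" "pathstart g2 = u" "pathfinish g2 = y"
    unfolding g1_def g2_def using g r by (auto simp: pathstart_def pathfinish_def subpath_def)
  have im: "path_image g1 = g ` {0..r}" "path_image g2 = g ` {r..1}"
    unfolding g1_def g2_def using r by (auto simp: path_image_subpath)
  have inj: "inj_on g {0..1}" using g(1) by (simp add: arc_def)
  have sub: "path_image g1 \<subseteq> path_image g" "path_image g2 \<subseteq> path_image g"
    unfolding im unfolding path_image_def using r by auto
  have yx: "y \<notin> path_image g1" "x \<notin> path_image g2" "path_image g1 \<inter> path_image g2 \<subseteq> {u}"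
    using inj r r01 g(2,3) unfolding im inj_on_def pathstart_def pathfinish_def by fastforce+
  have "path_image g1 \<inter> path_image h1 \<subseteq> {x}" "path_image g2 \<inter> path_image h1 = {}"
    using disj(2) sub yx by blast+
  moreover have "path_image g2 \<inter> path_image h2 \<subseteq> {y}" "path_image g1 \<inter> path_image h2 = {}"
    using disj(3) sub yx by blast+
  moreover have "path_image c \<inter> path_image g1 \<subseteq> {x}" "path_image c \<inter> path_image g2 \<subseteq> {y}"
    using disj(4) sub yx by blast+
  moreover have "path_image d \<inter> path_image g1 \<subseteq> {u}" "path_image d \<inter> path_image g2 \<subseteq> {u}"
    using disj(7) sub by blast+
  moreover have "path_image g1 \<union> path_image g2 \<union> path_image h1 \<union> path_image h2 \<union>
            path_image c \<union> path_image d \<subseteq> S"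
    using S sub by blast
  ultimately show ?thesis
    using disj yx(3) by (intro K4_not_exposed[OF arcs(1) ends(1,2) arcs(2) ends(3,4) h1 h2 c d])
qed

section \<open>Triangulated strips\<close>

text \<open>Line \<open>True\<close> is the upper one, vertices \<open>0\<close> and \<open>1\<close> lie on the lines \<open>False\<close> and \<open>True\<close>, and
  vertex \<open>j + 2\<close> lies on the line \<open>s j\<close>. Then \<open>lev s b j\<close> is the largest vertex up to \<open>j + 1\<close> on
  the line \<open>b\<close>.\<close>

primrec lev :: "(nat \<Rightarrow> bool) \<Rightarrow> bool \<Rightarrow> nat \<Rightarrow> nat" where
  "lev s b 0 = of_bool b"
| "lev s b (Suc j) = (if s j = b then j + 2 else lev s b j)"

definition rung :: "(nat \<Rightarrow> bool) \<Rightarrow> nat \<Rightarrow> nat set" where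
  "rung s j = {lev s False j, lev s True j}"

definition rail :: "(nat \<Rightarrow> bool) \<Rightarrow> nat \<Rightarrow> nat set" where
  "rail s j = {lev s (s j) j, j + 2}"

text \<open>There are \<open>t\<close> triangles on the vertices \<open>0, ..., t + 1\<close>; the
  \<open>j\<close>-th one is bounded by \<open>rung s j\<close>, \<open>rail s j\<close> and
  \<open>rung s (Suc j)\<close>.\<close>

definition strip_edges :: "(nat \<Rightarrow> bool) \<Rightarrow> nat \<Rightarrow> nat set set" where
  "strip_edges s t = rung s ` {..t} \<union> rail s ` {..<t}"

text \<open>For \<open>v = 0\<close> the difference \<open>v - 2\<close> truncates to
  \<open>0\<close>; the guard keeps vertex \<open>0\<close> on the lower line whatever
  \<open>s 0\<close> is.\<close>

definition side :: "(nat \<Rightarrow> bool) \<Rightarrow> nat \<Rightarrow> bool" where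
  "side s v \<longleftrightarrow> v = 1 \<or> 2 \<le> v \<and> s (v - 2)"

definition pos :: "(nat \<Rightarrow> bool) \<Rightarrow> nat \<Rightarrow> complex" where
  "pos s v = Complex (real v) (of_bool (side s v))"

text \<open>Edges are unordered, but a drawing needs one directed path for each of them;
  \<open>Min\<close> and \<open>Max\<close> fix the direction.\<close>

definition seg :: "(nat \<Rightarrow> bool) \<Rightarrow> nat set \<Rightarrow> real \<Rightarrow> complex" where
  "seg s e = linepath (pos s (Min e)) (pos s (Max e))"

text \<open>Abscissa of the point at height \<open>y\<close> on the line through the \<open>j\<close>-th rung.\<close>

definition rung_x :: "(nat \<Rightarrow> bool) \<Rightarrow> nat \<Rightarrow> real \<Rightarrow> real" where
  "rung_x s j y = (1 - y) * real (lev s False j) + y * real (lev s True j)"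

text \<open>Consecutive rungs share their end on the line opposite to \<open>s j\<close>, so the
  region between them is an open triangle.\<close>

definition tri :: "(nat \<Rightarrow> bool) \<Rightarrow> nat \<Rightarrow> complex set" where
  "tri s j = {z. 0 < Im z \<and> Im z < 1 \<and> rung_x s j (Im z) < Re z \<and> Re z < rung_x s (Suc j) (Im z)}"

section \<open>Order of the vertices and rungs along the two lines\<close>

lemma side_lev [simp]: "side s (lev s b j) = b"
  by (induction j) (auto simp: side_def)

lemma side_Suc_Suc [simp]: "side s (Suc (Suc j)) = s j"
  by (simp add: side_def)

lemma lev_le: "lev s b j \<le> Suc j"
  by (induction j) auto

lemma lev_mono: "i \<le> j \<Longrightarrow> lev s b i \<le> lev s b j"
proof (induction j rule: dec_induct)
  case (step j)
  then show ?case using lev_le[of s b j] by auto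
qed simp

lemma lev_strict: "lev s (s j) j < lev s (s j) (Suc j)"
  using lev_le[of s "s j" j] by simp

lemma lev_cases: "v \<le> Suc t \<Longrightarrow> \<exists>j\<le>t. \<exists>b. v = lev s b j"
proof (induction t)
  case 0
  then have "v = lev s False 0 \<or> v = lev s True 0" by auto
  then show ?case by blast
next
  case (Suc t)
  show ?case
  proof (cases "v \<le> Suc t")
    case True
    then show ?thesis using Suc.IH by (meson le_SucI)
  next
    case False
    then have "v = lev s (s t) (Suc t)" using Suc.prems by auto
    then show ?thesis by blast
  qed
qed

text \<open>Monotonicity in the index leaves no vertex of a line strictly between the ends of a
  rail; so whatever meets a rail in a vertex of its line meets it in an end.\<close>

lemma lev_between:
  assumes "lev s b j \<le> lev s b i" "lev s b i \<le> lev s b (Suc j)"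
  shows "lev s b i = lev s b j \<or> lev s b i = lev s b (Suc j)"
  using assms lev_mono[of i j s b] lev_mono[of "Suc j" i s b] by (meson le_antisym not_less_eq_eq)

lemma rail_eq: "rail s j = {lev s (s j) j, lev s (s j) (Suc j)}"
  by (simp add: rail_def)

lemma lev_in_rung: "lev s b j \<in> rung s j"
  by (cases b) (auto simp: rung_def)

lemma rung_subset: "rung s j \<subseteq> {..Suc j}"
  by (auto simp: rung_def lev_le)

lemma rail_subset: "rail s j \<subseteq> {..Suc (Suc j)}"
  using lev_le[of s "s j" j] by (auto simp: rail_def)

lemma rung_ends_distinct: "lev s False j \<noteq> lev s True j"
  using side_lev by metis

lemma rail_ends_distinct: "lev s (s j) j \<noteq> j + 2"
  using lev_le[of s "s j" j] by simp

lemma strip_simple: "simple_graph {..Suc t} (strip_edges s t)"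
proof -
  have "rung s j \<subseteq> {..Suc t}" if "j \<le> t" for j
    using rung_subset[of s j] that by (auto dest!: subsetD)
  moreover have "rail s j \<subseteq> {..Suc t}" if "j < t" for j
    using rail_subset[of s j] that by (auto dest!: subsetD)
  moreover have "card (rung s j) = 2" "card (rail s j) = 2" for j
    using rung_ends_distinct[of s j] rail_ends_distinct[of s j] by (auto simp: rung_def rail_def)
  ultimately show ?thesis
    by (auto simp: simple_graph_def strip_edges_def)
qed

text \<open>A rung has an end on each of the two lines, a rail has both ends on the same
  line.\<close>

lemma rung_neq_rail: "rung s i \<noteq> rail s j"
proof
  assume "rung s i = rail s j"
  then have "side s ` rung s i = side s ` rail s j" by simp
  then show False by (auto simp: rung_def rail_eq)
qed

lemma inj_pos: "inj (pos s)"
  by (auto simp: inj_def pos_def)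

lemma rung_x_of_bool [simp]: "rung_x s j (of_bool b) = real (lev s b j)"
  by (cases b) (auto simp: rung_x_def)

lemma rung_x_01 [simp]: "rung_x s j 0 = real (lev s False j)" "rung_x s j 1 = real (lev s True j)"
  by (auto simp: rung_x_def)

lemma rung_x_mono:
  assumes "i \<le> j" "0 \<le> y" "y \<le> 1"
  shows "rung_x s i y \<le> rung_x s j y"
  unfolding rung_x_def using assms lev_mono[OF assms(1), of s]
  by (intro add_mono mult_left_mono) auto

text \<open>From one rung to the next exactly one end moves to the right, and at heights strictly
  between 0 and 1 this end has positive weight.\<close>

lemma rung_x_Suc_strict:
  assumes "0 < y" "y < 1"
  shows "rung_x s j y < rung_x s (Suc j) y"
proof (cases "s j")
  case True
  then show ?thesis unfolding rung_x_def using assms lev_strict[of s j] by simp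
next
  case False
  then show ?thesis unfolding rung_x_def using assms lev_strict[of s j] by simp
qed

lemma rung_x_strict:
  assumes "i < j" "0 < y" "y < 1"
  shows "rung_x s i y < rung_x s j y"
  using rung_x_Suc_strict[OF assms(2,3), of s i] rung_x_mono[of "Suc i" j y s] assms by simp

lemma rung_x_convex:
  "rung_x s j ((1 - u) * y + u * y') = (1 - u) * rung_x s j y + u * rung_x s j y'"
  by (simp add: rung_x_def algebra_simps)

lemma continuous_rung_x: "continuous_on UNIV (\<lambda>z. rung_x s j (Im z))"
  unfolding rung_x_def by (intro continuous_intros)

section \<open>The straight-line drawing of the strip\<close>

lemma path_image_seg:
  assumes "a \<noteq> b" shows "path_image (seg s {a, b}) = closed_segment (pos s a) (pos s b)"
    and "arc (seg s {a, b})" and "{pathstart (seg s {a, b}), pathfinish (seg s {a, b})} = pos s ` {a, b}"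
  using assms injD[OF inj_pos, of s a b]
  by (auto simp: seg_def closed_segment_commute min_def max_def intro!: arc_linepath)

lemma closed_segment_complex_iff:
  "z \<in> closed_segment a b \<longleftrightarrow> (\<exists>u\<in>{0..1}. Re z = (1 - u) * Re a + u * Re b \<and> Im z = (1 - u) * Im a + u * Im b)"
  by (auto simp: in_segment complex_eq_iff)

lemma path_image_rung:
  "path_image (seg s (rung s j)) = {z. 0 \<le> Im z \<and> Im z \<le> 1 \<and> Re z = rung_x s j (Im z)}"
proof -
  have "path_image (seg s (rung s j)) = closed_segment (pos s (lev s False j)) (pos s (lev s True j))"
    unfolding rung_def by (rule path_image_seg[OF rung_ends_distinct])
  also have "\<dots> = {z. 0 \<le> Im z \<and> Im z \<le> 1 \<and> Re z = rung_x s j (Im z)}"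
    unfolding set_eq_iff closed_segment_complex_iff pos_def side_lev rung_x_def by simp
  finally show ?thesis .
qed

lemma path_image_rail:
  "path_image (seg s (rail s j)) =
    {z. Im z = of_bool (s j) \<and> rung_x s j (Im z) \<le> Re z \<and> Re z \<le> rung_x s (Suc j) (Im z)}" (is "_ = ?R")
proof -
  have *: "path_image (seg s (rail s j)) = closed_segment (pos s (lev s (s j) j)) (pos s (lev s (s j) (Suc j)))"
    unfolding rail_eq by (rule path_image_seg[OF less_imp_neq[OF lev_strict]])
  have "z \<in> closed_segment (pos s (lev s (s j) j)) (pos s (lev s (s j) (Suc j))) \<longleftrightarrow> z \<in> ?R" for z
  proof -
    have conv: "(1 - u) * c + u * c = c" for u c :: real
      by (simp add: left_diff_distrib)
    have "z \<in> closed_segment (pos s (lev s (s j) j)) (pos s (lev s (s j) (Suc j))) \<longleftrightarrow>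
      Re z \<in> closed_segment (real (lev s (s j) j)) (real (lev s (s j) (Suc j))) \<and> Im z = of_bool (s j)"
      unfolding closed_segment_complex_iff in_segment pos_def side_lev complex.sel conv real_scaleR_def
      by auto
    also have "Re z \<in> closed_segment (real (lev s (s j) j)) (real (lev s (s j) (Suc j))) \<longleftrightarrow>
      real (lev s (s j) j) \<le> Re z \<and> Re z \<le> real (lev s (s j) (Suc j))"
      using lev_strict[of s j] by (subst closed_segment_eq_real_ivl1) (auto simp del: lev.simps)
    finally show ?thesis by (cases "Im z = of_bool (s j)") (simp_all del: lev.simps)
  qed
  then show ?thesis unfolding * by blast
qed

lemma strip_edge_cases:
  assumes "e \<in> strip_edges s t"
  obtains j where "j \<le> t" "e = rung s j" | j where "j < t" "e = rail s j"
  using assms by (auto simp: strip_edges_def)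

lemma pos_eqI: "Im z = of_bool b \<Longrightarrow> Re z = real (lev s b j) \<Longrightarrow> z = pos s (lev s b j)"
  by (simp add: pos_def complex_eq_iff)

text \<open>Strictly between the two lines the rungs are strictly ordered, so two of them can only
  meet at height 0 or 1, that is, in a common vertex.\<close>

lemma rung_rung_inter:
  assumes "i < j"
  shows "path_image (seg s (rung s i)) \<inter> path_image (seg s (rung s j)) \<subseteq> pos s ` (rung s i \<inter> rung s j)"
proof
  fix z assume "z \<in> path_image (seg s (rung s i)) \<inter> path_image (seg s (rung s j))"
  then have z: "0 \<le> Im z" "Im z \<le> 1" "Re z = rung_x s i (Im z)" "Re z = rung_x s j (Im z)"
    by (auto simp: path_image_rung)
  then have "Im z = 0 \<or> Im z = 1"
    using rung_x_strict[OF assms, of "Im z" s] by linarith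
  then obtain b where b: "Im z = of_bool b" by (metis of_bool_eq)
  have "lev s b i = lev s b j" "z = pos s (lev s b i)"
    using z(3,4) b by (auto intro: pos_eqI)
  then show "z \<in> pos s ` (rung s i \<inter> rung s j)"
    using lev_in_rung[of s b] by (metis IntI imageI)
qed

lemma rung_rail_inter:
  "path_image (seg s (rung s i)) \<inter> path_image (seg s (rail s j)) \<subseteq> pos s ` (rung s i \<inter> rail s j)"
proof
  fix z assume "z \<in> path_image (seg s (rung s i)) \<inter> path_image (seg s (rail s j))"
  then have b: "Im z = of_bool (s j)" and z: "Re z = real (lev s (s j) i)"
    "real (lev s (s j) j) \<le> Re z" "Re z \<le> real (lev s (s j) (Suc j))"
    by (auto simp: path_image_rung path_image_rail simp del: lev.simps)
  then have "lev s (s j) i \<in> rail s j"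
    using lev_between[of s "s j" j i] unfolding rail_eq by (simp del: lev.simps)
  moreover have "z = pos s (lev s (s j) i)" using b z(1) by (rule pos_eqI)
  ultimately show "z \<in> pos s ` (rung s i \<inter> rail s j)"
    using lev_in_rung[of s "s j" i] by blast
qed

text \<open>Of two rails on the same line, the earlier one ends no later than the other one
  starts.\<close>

lemma rail_rail_inter:
  assumes "i < j"
  shows "path_image (seg s (rail s i)) \<inter> path_image (seg s (rail s j)) \<subseteq> pos s ` (rail s i \<inter> rail s j)"
proof
  fix z assume "z \<in> path_image (seg s (rail s i)) \<inter> path_image (seg s (rail s j))"
  then have b: "Im z = of_bool (s j)" and eq: "s i = s j" and z: "Re z \<le> real (lev s (s i) (Suc i))"
    "real (lev s (s j) j) \<le> Re z"
    by (auto simp: path_image_rail of_bool_eq_iff simp del: lev.simps)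
  have "lev s (s j) (Suc i) \<le> lev s (s j) j" using assms by (intro lev_mono) auto
  then have "Re z = real (lev s (s j) j)" "lev s (s j) j = lev s (s i) (Suc i)"
    using z unfolding eq by linarith+
  then have "z = pos s (lev s (s j) j)" "lev s (s j) j \<in> rail s i \<inter> rail s j"
    using b pos_eqI[of z "s j" s j] by (simp_all add: rail_eq del: lev.simps)
  then show "z \<in> pos s ` (rail s i \<inter> rail s j)" by blast
qed

lemma pos_in_edge:
  assumes "pos s v \<in> path_image (seg s e)" "e \<in> strip_edges s t"
  shows "v \<in> e"
proof -
  obtain i b where v: "v = lev s b i" using lev_cases[of v v s] by auto
  have p: "Re (pos s v) = real (lev s b i)" "Im (pos s v) = of_bool b"
    unfolding v by (simp_all add: pos_def)
  show ?thesis using assms(2)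
  proof (cases rule: strip_edge_cases)
    case (1 j)
    then have "lev s b i = lev s b j"
      using assms(1) p by (auto simp: path_image_rung)
    then show ?thesis using 1 v lev_in_rung[of s b j] by simp
  next
    case (2 j)
    then have b: "b = s j" and "lev s (s j) j \<le> lev s (s j) i" "lev s (s j) i \<le> lev s (s j) (Suc j)"
      using assms(1) p by (auto simp: path_image_rail of_bool_eq_iff simp del: lev.simps)
    then show ?thesis using lev_between[of s "s j" j i] 2 v unfolding b rail_eq by (simp del: lev.simps)
  qed
qed

lemma strip_edges_doubleton:
  assumes "e \<in> strip_edges s t" obtains a b where "a \<noteq> b" "e = {a, b}"
  using assms rung_ends_distinct[of s] rail_ends_distinct[of s]
  by (cases rule: strip_edge_cases) (auto simp: rung_def rail_def)

lemma strip_planar_drawing: "planar_drawing {..Suc t} (strip_edges s t) (pos s) (seg s)"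
  unfolding planar_drawing_def
proof (intro conjI ballI impI)
  show "inj_on (pos s) {..Suc t}" using inj_pos by (rule inj_on_subset) auto
  fix e assume e: "e \<in> strip_edges s t"
  obtain a b where ab: "a \<noteq> b" "e = {a, b}" using e by (rule strip_edges_doubleton)
  show arc: "arc (seg s e)" and ends: "{pathstart (seg s e), pathfinish (seg s e)} = pos s ` e"
    using path_image_seg[OF ab(1), of s] ab(2) by auto
  have "e \<subseteq> {..Suc t}" using strip_simple[of t s] e by (auto simp: simple_graph_def)
  moreover have "pos s ` e \<subseteq> path_image (seg s e)" unfolding ends[symmetric] by auto
  ultimately show "path_image (seg s e) \<inter> pos s ` {..Suc t} = pos s ` e"
    using pos_in_edge[OF _ e] by blast
  fix f assume f: "f \<in> strip_edges s t" and ne: "e \<noteq> f"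
  show "path_image (seg s e) \<inter> path_image (seg s f) \<subseteq> pos s ` (e \<inter> f)"
    using e
  proof (cases rule: strip_edge_cases)
    case (1 i)
    show ?thesis using f
    proof (cases rule: strip_edge_cases)
      case (1 j)
      with \<open>e = rung s i\<close> ne have "i < j \<or> j < i" by (metis nat_neq_iff)
      then show ?thesis using rung_rung_inter[of i j s] rung_rung_inter[of j i s] 1 \<open>e = rung s i\<close>
        by (auto simp: Int_commute)
    next
      case (2 j)
      then show ?thesis using rung_rail_inter 1 by simp
    qed
  next
    case (2 i)
    show ?thesis using f
    proof (cases rule: strip_edge_cases)
      case (1 j)
      then show ?thesis using rung_rail_inter[of s j i] 2 by (simp add: Int_commute)
    next
      case (2 j)
      with \<open>e = rail s i\<close> ne have "i < j \<or> j < i" by (metis nat_neq_iff)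
      then show ?thesis using rail_rail_inter[of i j s] rail_rail_inter[of j i s] 2 \<open>e = rail s i\<close>
        by (auto simp: Int_commute)
    qed
  qed
qed

subsection \<open>Faces and weak dual\<close>

lemma strip_edge_ends_in_path_image: "e \<in> strip_edges s t \<Longrightarrow> pos s ` e \<subseteq> path_image (seg s e)"
  using strip_planar_drawing[of t s] unfolding planar_drawing_def by blast

text \<open>Every vertex is an end of a rung, so the rungs and rails cover the drawing. Membership
  becomes a comparison with \<open>rung_x\<close> at the height of the point.\<close>

lemma drawing_image_strip:
  "z \<in> drawing_image {..Suc t} (strip_edges s t) (pos s) (seg s) \<longleftrightarrow>
    (\<exists>j\<le>t. 0 \<le> Im z \<and> Im z \<le> 1 \<and> Re z = rung_x s j (Im z)) \<or>
    (\<exists>j<t. Im z = of_bool (s j) \<and> rung_x s j (Im z) \<le> Re z \<and> Re z \<le> rung_x s (Suc j) (Im z))"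
proof -
  have "pos s v \<in> (\<Union>e\<in>strip_edges s t. path_image (seg s e))" if "v \<le> Suc t" for v
  proof -
    obtain j b where "j \<le> t" "v = lev s b j" using lev_cases \<open>v \<le> Suc t\<close> by blast
    moreover from this have "rung s j \<in> strip_edges s t" by (auto simp: strip_edges_def)
    ultimately show ?thesis using lev_in_rung[of s b j] strip_edge_ends_in_path_image by blast
  qed
  then have "drawing_image {..Suc t} (strip_edges s t) (pos s) (seg s) = (\<Union>e\<in>strip_edges s t. path_image (seg s e))"
    unfolding drawing_image_def by blast
  also have "\<dots> = (\<Union>j\<in>{..t}. path_image (seg s (rung s j))) \<union> (\<Union>j\<in>{..<t}. path_image (seg s (rail s j)))"
    by (simp add: strip_edges_def)
  finally show ?thesis
    unfolding path_image_rung path_image_rail by (simp only: Un_iff UN_iff mem_Collect_eq Bex_def lessThan_iff atMost_iff)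
qed

lemma connected_unbounded_in_outside:
  assumes "connected U" "\<not> bounded U" "U \<inter> S = {}"
  shows "U \<subseteq> outside S"
proof
  fix x assume x: "x \<in> U"
  have "U \<subseteq> connected_component_set (- S) x"
    using assms x by (intro connected_component_maximal) auto
  then have "\<not> bounded (connected_component_set (- S) x)"
    using assms(2) bounded_subset by blast
  then show "x \<in> outside S"
    using assms(3) x by (auto simp: outside_def)
qed

text \<open>A connected set that properly extends \<open>U\<close> would meet the frontier of
  \<open>U\<close>, which is disjoint from \<open>S\<close>.\<close>

lemma open_connected_component:
  assumes "open U" "connected U" "U \<noteq> {}" "U \<subseteq> S" "frontier U \<inter> S = {}"
  shows "U \<in> components S"
  unfolding in_components_maximal
proof (intro conjI allI impI)
  fix T assume T: "T \<noteq> {} \<and> U \<subseteq> T \<and> T \<subseteq> S \<and> connected T"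
  then have "T \<inter> frontier U = {}" using assms(5) by blast
  then have "T - U = {}"
    using connected_Int_frontier[of T U] T assms(3) by blast
  then show "T = U" using T by blast
qed (use assms in auto)

lemma unbounded_if_norm_ge:
  fixes U :: "'a::real_normed_vector set"
  assumes "\<And>r. \<exists>z\<in>U. r < norm z" shows "\<not> bounded U"
  using assms unfolding bounded_iff by (meson not_le)

lemma outside_upper: "{z. 1 < Im z} \<subseteq> outside (drawing_image {..Suc t} (strip_edges s t) (pos s) (seg s))"
proof (rule connected_unbounded_in_outside)
  show "connected {z. 1 < Im z}"
    using convex_halfspace_Im_gt[of 1] by (simp add: convex_connected)
  show "\<not> bounded {z. 1 < Im z}"
  proof (rule unbounded_if_norm_ge)
    fix r :: real
    show "\<exists>z\<in>{z. 1 < Im z}. r < norm z"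
      using abs_Im_le_cmod[of "Complex 0 (2 + \<bar>r\<bar>)"] by (intro bexI[of _ "Complex 0 (2 + \<bar>r\<bar>)"]) auto
  qed
  show "{z. 1 < Im z} \<inter> drawing_image {..Suc t} (strip_edges s t) (pos s) (seg s) = {}"
    by (auto simp: drawing_image_strip split: split_of_bool_asm)
qed

lemma outside_lower: "{z. Im z < 0} \<subseteq> outside (drawing_image {..Suc t} (strip_edges s t) (pos s) (seg s))"
proof (rule connected_unbounded_in_outside)
  show "connected {z. Im z < 0}"
    using convex_halfspace_Im_lt[of 0] by (simp add: convex_connected)
  show "\<not> bounded {z. Im z < 0}"
  proof (rule unbounded_if_norm_ge)
    fix r :: real
    show "\<exists>z\<in>{z. Im z < 0}. r < norm z"
      using abs_Im_le_cmod[of "Complex 0 (- 1 - \<bar>r\<bar>)"] by (intro bexI[of _ "Complex 0 (- 1 - \<bar>r\<bar>)"]) auto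
  qed
  show "{z. Im z < 0} \<inter> drawing_image {..Suc t} (strip_edges s t) (pos s) (seg s) = {}"
    by (auto simp: drawing_image_strip split: split_of_bool_asm)
qed

lemma horizontal_ray_outside:
  fixes z :: complex and \<sigma> :: real
  assumes "\<sigma> = 1 \<or> \<sigma> = - 1" and "\<And>x. 0 \<le> x \<Longrightarrow> Complex (Re z + \<sigma> * x) (Im z) \<notin> D"
  shows "z \<in> outside D"
proof -
  let ?U = "(\<lambda>x. Complex (Re z + \<sigma> * x) (Im z)) ` {0..}"
  have "continuous_on {0..} (\<lambda>x. Complex (Re z + \<sigma> * x) (Im z))"
    unfolding Complex_eq by (intro continuous_intros)
  then have "connected ?U"
    by (intro connected_continuous_image) auto
  moreover have "\<not> bounded ?U"
  proof (rule unbounded_if_norm_ge)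
    fix r :: real
    let ?x = "\<bar>Re z\<bar> + \<bar>r\<bar> + 1"
    have "r < \<bar>Re z + \<sigma> * ?x\<bar>" using assms(1) by auto
    also have "\<dots> \<le> cmod (Complex (Re z + \<sigma> * ?x) (Im z))"
      using abs_Re_le_cmod[of "Complex (Re z + \<sigma> * ?x) (Im z)"] by simp
    finally show "\<exists>w\<in>?U. r < norm w" by (intro bexI[OF _ imageI, of _ _ ?x]) auto
  qed
  moreover have "?U \<inter> D = {}" using assms(2) by auto
  ultimately have "?U \<subseteq> outside D" by (rule connected_unbounded_in_outside)
  moreover have "Complex (Re z + \<sigma> * 0) (Im z) \<in> ?U" by (rule imageI) simp
  ultimately have "Complex (Re z + \<sigma> * 0) (Im z) \<in> outside D" by blast
  then show ?thesis by simp
qed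

text \<open>This handles points on the two lines themselves: they avoid the drawing, and any step in
  direction \<open>\<sigma>\<close> leads into a half-plane already known to be outside.\<close>

lemma vertical_ray_outside:
  fixes z :: complex and \<sigma> :: real
  assumes "z \<notin> D" "U \<subseteq> outside D" "\<And>x. 0 < x \<Longrightarrow> Complex (Re z) (Im z + \<sigma> * x) \<in> U"
  shows "z \<in> outside D"
proof -
  let ?R = "(\<lambda>x. Complex (Re z) (Im z + \<sigma> * x)) ` {0..1}"
  have "continuous_on {0..1} (\<lambda>x. Complex (Re z) (Im z + \<sigma> * x))"
    unfolding Complex_eq by (intro continuous_intros)
  then have c: "connected ?R"
    by (intro connected_continuous_image) auto
  have "Complex (Re z) (Im z + \<sigma> * x) \<notin> D" if "0 \<le> x" for x
  proof (cases "x = 0")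
    case False
    then have "Complex (Re z) (Im z + \<sigma> * x) \<in> outside D" using assms(2,3) that by auto
    then show ?thesis using outside_no_overlap[of D] by blast
  qed (use assms(1) in simp)
  then have "?R \<subseteq> - D" by auto
  moreover have "Complex (Re z) (Im z + \<sigma> * 1) \<in> ?R" "Complex (Re z) (Im z + \<sigma> * 0) \<in> ?R"
    by (rule imageI, simp)+
  ultimately have "connected_component (- D) (Complex (Re z) (Im z + \<sigma> * 1)) z"
    using c unfolding connected_component_def by (intro exI[of _ ?R]) simp
  moreover have "Complex (Re z) (Im z + \<sigma> * 1) \<in> outside D"
    using assms(2) assms(3)[of 1] by auto
  ultimately show ?thesis by (rule outside_same_component)
qed

text \<open>From height at least 1 or at most 0 a vertical ray escapes. Strictly between the lines
  only rungs occur, and a point is left of all of them, right of all of them, or between two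
  consecutive ones; in the first two cases a horizontal ray escapes.\<close>

lemma strip_complement_cases:
  assumes "z \<notin> drawing_image {..Suc t} (strip_edges s t) (pos s) (seg s)" (is "z \<notin> ?D")
  shows "z \<in> outside ?D \<or> (\<exists>j<t. z \<in> tri s j)"
proof -
  consider "1 \<le> Im z" | "Im z \<le> 0" | "0 < Im z" "Im z < 1" by linarith
  then show ?thesis
  proof cases
    case 1
    then show ?thesis
      using vertical_ray_outside[OF assms outside_upper, of 1] by simp
  next
    case 2
    then show ?thesis
      using vertical_ray_outside[OF assms outside_lower, of "-1"] by simp
  next
    case 3
    have off: "Re z \<noteq> rung_x s j (Im z)" if "j \<le> t" for j
      using assms that 3 by (auto simp: drawing_image_strip)
    have mono: "rung_x s i (Im z) \<le> rung_x s j (Im z)" if "i \<le> j" for i j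
      using rung_x_mono[OF that] 3 by simp
    have D: "Complex x (Im z) \<in> ?D \<longleftrightarrow> (\<exists>j\<le>t. x = rung_x s j (Im z))" for x
    proof -
      have "Im z \<noteq> of_bool b" for b using 3 by (cases b) auto
      then show ?thesis using 3 by (simp add: drawing_image_strip)
    qed
    consider "Re z < rung_x s 0 (Im z)" | "rung_x s t (Im z) < Re z"
      | "rung_x s 0 (Im z) < Re z" "Re z < rung_x s t (Im z)"
      using off[of 0] off[of t] by fastforce
    then show ?thesis
    proof cases
      case 1
      have "z \<in> outside ?D"
      proof (rule horizontal_ray_outside[of "-1"])
        fix x :: real assume "0 \<le> x"
        then have "Re z + - 1 * x < rung_x s j (Im z)" for j using 1 mono[of 0 j] by simp
        then show "Complex (Re z + - 1 * x) (Im z) \<notin> ?D" unfolding D by (metis less_irrefl)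
      qed simp
      then show ?thesis ..
    next
      case 2
      have "z \<in> outside ?D"
      proof (rule horizontal_ray_outside[of "1"])
        fix x :: real assume "0 \<le> x"
        then have "rung_x s j (Im z) < Re z + 1 * x" if "j \<le> t" for j using 2 mono[OF that] by simp
        then show "Complex (Re z + 1 * x) (Im z) \<notin> ?D" unfolding D by (metis less_irrefl)
      qed simp
      then show ?thesis ..
    next
      case 4: 3
      \<comment> \<open>The first rung to the right of \<open>z\<close>; its predecessor is then to
        the left, as \<open>z\<close> lies on no rung.\<close>
      define j where "j = (LEAST j. Re z < rung_x s j (Im z))"
      have j: "Re z < rung_x s j (Im z)" unfolding j_def using 4(2) by (rule LeastI)
      have "j \<noteq> 0" using j 4(1) by (metis less_asym)
      then obtain i where i: "j = Suc i" by (cases j) auto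
      have "j \<le> t" unfolding j_def using 4(2) by (rule Least_le)
      moreover have "\<not> Re z < rung_x s i (Im z)" using not_less_Least[of i] i unfolding j_def by (metis lessI)
      ultimately have "z \<in> tri s i" "i < t"
        using off[of i] i j 3 by (auto simp: tri_def)
      then show ?thesis by blast
    qed
  qed
qed

definition closed_tri :: "(nat \<Rightarrow> bool) \<Rightarrow> nat \<Rightarrow> complex set" where
  "closed_tri s j = {z. 0 \<le> Im z \<and> Im z \<le> 1 \<and> rung_x s j (Im z) \<le> Re z \<and> Re z \<le> rung_x s (Suc j) (Im z)}"

lemma tri_subset_closed_tri: "tri s j \<subseteq> closed_tri s j"
  by (auto simp: tri_def closed_tri_def)

lemma tri_nonempty: "tri s j \<noteq> {}"
proof -
  obtain x where "rung_x s j (1/2) < x" "x < rung_x s (Suc j) (1/2)"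
    using dense[OF rung_x_Suc_strict[of "1/2" s j]] by auto
  then have "Complex x (1/2) \<in> tri s j" by (simp add: tri_def)
  then show ?thesis by blast
qed

lemma open_tri: "open (tri s j)"
  unfolding tri_def
  by (intro open_Collect_conj open_Collect_less continuous_rung_x continuous_intros)

lemma closed_closed_tri: "closed (closed_tri s j)"
  unfolding closed_tri_def
  by (intro closed_Collect_conj closed_Collect_le continuous_rung_x continuous_intros)

text \<open>Any positive share of an interior point makes the weak inequalities of
  \<open>closed_tri\<close> strict. This yields both the convexity and the closure of
  \<open>tri\<close>.\<close>

lemma tri_segment:
  assumes "z \<in> closed_tri s j" "w \<in> tri s j" "0 < u" "u \<le> 1"
  shows "(1 - u) *\<^sub>R z + u *\<^sub>R w \<in> tri s j"
proof -
  have combine: "(1 - u) * a + u * b < (1 - u) * a' + u * b'" if "a \<le> a'" "b < b'" for a a' b b' :: real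
    using that assms(3,4) by (intro add_le_less_mono mult_left_mono mult_strict_left_mono) auto
  show ?thesis
    using assms(1,2) combine[of 0 "Im z" 0 "Im w"] combine[of "Im z" 1 "Im w" 1]
      combine[of "rung_x s j (Im z)" "Re z" "rung_x s j (Im w)" "Re w"]
      combine[of "Re z" "rung_x s (Suc j) (Im z)" "Re w" "rung_x s (Suc j) (Im w)"]
    unfolding tri_def closed_tri_def by (simp add: rung_x_convex)
qed

lemma convex_tri: "convex (tri s j)"
  unfolding convex_alt
proof (intro ballI allI impI)
  fix x y and u :: real assume a: "x \<in> tri s j" "y \<in> tri s j" "0 \<le> u \<and> u \<le> 1"
  show "(1 - u) *\<^sub>R x + u *\<^sub>R y \<in> tri s j"
    using a tri_segment[of x s j y u] tri_subset_closed_tri by (cases "u = 0") auto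
qed

lemma closure_tri: "closure (tri s j) = closed_tri s j"
proof
  show "closure (tri s j) \<subseteq> closed_tri s j"
    using tri_subset_closed_tri closed_closed_tri by (rule closure_minimal)
  show "closed_tri s j \<subseteq> closure (tri s j)"
  proof
    fix z assume z: "z \<in> closed_tri s j"
    obtain w where w: "w \<in> tri s j" using tri_nonempty by blast
    let ?f = "\<lambda>u. (1 - u) *\<^sub>R z + u *\<^sub>R w"
    have "?f ` closure {0<..<1} \<subseteq> closure (tri s j)"
      using tri_segment[OF z w]
      by (intro image_closure_subset) (auto intro!: continuous_intros closure_subset[THEN subsetD])
    moreover have "z \<in> ?f ` closure {0<..<1}" by (rule image_eqI[of _ _ 0]) auto
    ultimately show "z \<in> closure (tri s j)" by blast
  qed
qed

lemma frontier_tri: "frontier (tri s j) = closed_tri s j - tri s j"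
  by (simp add: frontier_def closure_tri interior_open open_tri)

lemma tri_off_drawing:
  assumes "z \<in> tri s i"
  shows "z \<notin> drawing_image {..Suc t} (strip_edges s t) (pos s) (seg s)"
proof
  assume "z \<in> drawing_image {..Suc t} (strip_edges s t) (pos s) (seg s)"
  then obtain j where "Re z = rung_x s j (Im z)"
    using assms by (auto simp: drawing_image_strip tri_def)
  moreover have "j \<le> i \<or> Suc i \<le> j" by linarith
  ultimately show False
    using assms rung_x_mono[of j i "Im z" s] rung_x_mono[of "Suc i" j "Im z" s] by (auto simp: tri_def)
qed

lemma frontier_tri_drawing:
  assumes "j < t"
  shows "frontier (tri s j) \<subseteq> drawing_image {..Suc t} (strip_edges s t) (pos s) (seg s)"
proof
  fix z assume "z \<in> frontier (tri s j)"
  then have z: "0 \<le> Im z" "Im z \<le> 1" "rung_x s j (Im z) \<le> Re z" "Re z \<le> rung_x s (Suc j) (Im z)" "z \<notin> tri s j"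
    by (auto simp: frontier_tri closed_tri_def)
  show "z \<in> drawing_image {..Suc t} (strip_edges s t) (pos s) (seg s)"
  proof (cases "Re z = rung_x s j (Im z) \<or> Re z = rung_x s (Suc j) (Im z)")
    case True
    then show ?thesis using z(1,2) assms unfolding drawing_image_strip by (meson Suc_leI less_imp_le)
  next
    case False
    then have "Im z = 0 \<or> Im z = 1" using z by (auto simp: tri_def)
    then obtain b where b: "Im z = of_bool b" by (metis of_bool_eq)
    \<comment> \<open>On the opposite line both rungs have the same end, so \<open>z\<close> would
      lie on them; hence \<open>z\<close> is on the line of the rail.\<close>
    have "b = s j"
    proof (rule ccontr)
      assume "b \<noteq> s j"
      then have "lev s b (Suc j) = lev s b j" by auto
      then show False using z(3,4) False unfolding b rung_x_of_bool by simp
    qed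
    then show ?thesis using b z(3,4) assms unfolding drawing_image_strip by blast
  qed
qed

lemma tri_component:
  assumes "j < t"
  shows "tri s j \<in> components (- drawing_image {..Suc t} (strip_edges s t) (pos s) (seg s))"
proof (rule open_connected_component)
  show "tri s j \<subseteq> - drawing_image {..Suc t} (strip_edges s t) (pos s) (seg s)"
    using tri_off_drawing by blast
  show "frontier (tri s j) \<inter> - drawing_image {..Suc t} (strip_edges s t) (pos s) (seg s) = {}"
    using frontier_tri_drawing[OF assms] by blast
qed (simp_all add: open_tri convex_connected convex_tri tri_nonempty)

lemma bounded_tri: "bounded (tri s j)"
proof (rule bounded_subset)
  show "bounded (cball 0 (real (Suc j) + 2) :: complex set)" by simp
  show "tri s j \<subseteq> cball 0 (real (Suc j) + 2)"
  proof
    fix z assume z: "z \<in> tri s j"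
    then have y: "0 < Im z" "Im z < 1" by (auto simp: tri_def)
    have "real (lev s b (Suc j)) \<le> real (Suc (Suc j))" for b
      using lev_le[of s b "Suc j"] by (simp only: of_nat_le_iff)
    then have "rung_x s (Suc j) (Im z) \<le> (1 - Im z) * real (Suc (Suc j)) + Im z * real (Suc (Suc j))"
      unfolding rung_x_def using y
      by (intro add_mono mult_left_mono) (simp_all del: lev.simps)
    moreover have "0 \<le> rung_x s j (Im z)" using y by (simp add: rung_x_def)
    ultimately have "\<bar>Re z\<bar> \<le> real (Suc (Suc j))" using z by (auto simp: tri_def algebra_simps)
    then have "cmod z \<le> real (Suc (Suc j)) + 1" using cmod_le[of z] y by simp
    then show "z \<in> cball 0 (real (Suc j) + 2)" by simp
  qed
qed

text \<open>A bounded component contains no point of the outside, so by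
  \<open>strip_complement_cases\<close> it meets some triangle. That triangle is a component itself,
  and components do not overlap.\<close>

lemma strip_internal_faces:
  "internal_faces {..Suc t} (strip_edges s t) (pos s) (seg s) = tri s ` {..<t}" (is "?L = ?R")
proof
  let ?D = "drawing_image {..Suc t} (strip_edges s t) (pos s) (seg s)"
  show "?R \<subseteq> ?L" using tri_component bounded_tri by (auto simp: internal_faces_def)
  show "?L \<subseteq> ?R"
  proof
    fix F assume "F \<in> ?L"
    then have F: "F \<in> components (- ?D)" "bounded F" by (auto simp: internal_faces_def)
    then obtain z where z: "z \<in> - ?D" "F = connected_component_set (- ?D) z"
      by (auto simp: components_def)
    then have "z \<notin> outside ?D" using F(2) by (auto simp: outside_def)
    then obtain j where j: "j < t" "z \<in> tri s j" using strip_complement_cases z(1) by blast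
    moreover have "z \<in> F" using z by simp
    ultimately have "F = tri s j"
      using components_nonoverlap[OF F(1) tri_component[OF j(1)]] by blast
    then show "F \<in> ?R" using j by blast
  qed
qed

lemma tri_disjoint:
  assumes "i < j" shows "tri s i \<inter> tri s j = {}"
proof -
  have False if "z \<in> tri s i" "z \<in> tri s j" for z
    using that rung_x_mono[of "Suc i" j "Im z" s] assms by (auto simp: tri_def)
  then show ?thesis by blast
qed

lemma inj_tri: "inj (tri s)"
  using tri_disjoint tri_nonempty by (intro linorder_injI) (metis Int_absorb)

lemma rung_in_frontiers:
  "path_image (seg s (rung s (Suc i))) \<subseteq> frontier (tri s i) \<inter> frontier (tri s (Suc i))"
proof
  fix z assume "z \<in> path_image (seg s (rung s (Suc i)))"
  then have z: "0 \<le> Im z" "Im z \<le> 1" "Re z = rung_x s (Suc i) (Im z)"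
    by (auto simp: path_image_rung)
  then show "z \<in> frontier (tri s i) \<inter> frontier (tri s (Suc i))"
    using rung_x_mono[of i "Suc i" "Im z" s] rung_x_mono[of "Suc i" "Suc (Suc i)" "Im z" s]
    unfolding frontier_tri by (auto simp: closed_tri_def tri_def)
qed

text \<open>If \<open>j\<close> were larger than \<open>Suc i\<close>, both ends of the common edge
  would have to be the latest vertex of their line at step \<open>Suc i\<close> and still at step
  \<open>j\<close>. The ends lie on different lines, and one of the lines gets a new vertex in
  between.\<close>

lemma common_edge_consecutive:
  assumes e: "e \<in> strip_edges s t" "path_image (seg s e) \<subseteq> frontier (tri s i) \<inter> frontier (tri s j)" and "i < j"
  shows "j = Suc i"
proof (rule ccontr)
  assume "j \<noteq> Suc i"
  then have ij: "Suc (Suc i) \<le> j" using \<open>i < j\<close> by simp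
  have lev: "lev s (side s v) (Suc i) = v \<and> lev s (side s v) j = v" if "v \<in> e" for v
  proof -
    have "pos s v \<in> closed_tri s i \<inter> closed_tri s j"
      using e strip_edge_ends_in_path_image[OF e(1)] that unfolding frontier_tri by blast
    then have "lev s (side s v) j \<le> v" "v \<le> lev s (side s v) (Suc i)"
      by (auto simp: closed_tri_def pos_def simp del: lev.simps)
    then show ?thesis using lev_mono[of "Suc i" j s "side s v"] \<open>i < j\<close> by linarith
  qed
  obtain a b where ab: "a \<noteq> b" "e = {a, b}" using e(1) by (rule strip_edges_doubleton)
  have fix_ab: "lev s (side s a) j = a" "lev s (side s b) j = b" using lev ab(2) by blast+
  have "side s a \<noteq> side s b"
  proof
    assume eq: "side s a = side s b"
    have "lev s (side s a) j = lev s (side s b) j" unfolding eq by (rule refl)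
    then show False using fix_ab ab(1) by linarith
  qed
  then have "side s a = s (Suc i) \<or> side s b = s (Suc i)" by blast
  then obtain v where v: "v \<in> e" "side s v = s (Suc i)" using ab(2) by blast
  have "lev s (s (Suc i)) (Suc (Suc i)) \<le> lev s (s (Suc i)) j" using ij by (rule lev_mono)
  then show False using lev_strict[of s "Suc i"] lev[OF v(1)] unfolding v(2) by linarith
qed

lemma strip_weak_dual:
  assumes "1 \<le> t"
  shows "path_graph (internal_faces {..Suc t} (strip_edges s t) (pos s) (seg s))
           (weak_dual_edges {..Suc t} (strip_edges s t) (pos s) (seg s))"
proof -
  let ?xs = "map (tri s) [0..<t]"
  let ?W = "weak_dual_edges {..Suc t} (strip_edges s t) (pos s) (seg s)"
  have "?W = {{?xs ! i, ?xs ! Suc i} | i. Suc i < length ?xs}" (is "_ = ?P")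
  proof
    show "?P \<subseteq> ?W"
    proof
      fix A assume "A \<in> ?P"
      then obtain i where i: "Suc i < t" "A = {tri s i, tri s (Suc i)}" by auto
      moreover have "rung s (Suc i) \<in> strip_edges s t" using i by (auto simp: strip_edges_def)
      moreover have "tri s i \<noteq> tri s (Suc i)" using inj_tri by (metis injD n_not_Suc_n)
      ultimately show "A \<in> ?W"
        unfolding weak_dual_edges_def strip_internal_faces using rung_in_frontiers[of s i]
        by (intro CollectI exI[of _ "tri s i"] exI[of _ "tri s (Suc i)"]) auto
    qed
    show "?W \<subseteq> ?P"
    proof
      fix A assume "A \<in> ?W"
      then obtain i j e where *: "i < t" "j < t" "A = {tri s i, tri s j}" "tri s i \<noteq> tri s j"
        "e \<in> strip_edges s t" "path_image (seg s e) \<subseteq> frontier (tri s i) \<inter> frontier (tri s j)"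
        unfolding weak_dual_edges_def strip_internal_faces by blast
      have "i < j \<or> j < i" using *(4) by (metis nat_neq_iff)
      then have "j = Suc i \<or> i = Suc j"
        using common_edge_consecutive[OF *(5), of i j] common_edge_consecutive[OF *(5), of j i] *(6)
        by blast
      then show "A \<in> ?P"
      proof
        assume "j = Suc i"
        then show ?thesis using * by (intro CollectI exI[of _ i]) auto
      next
        assume "i = Suc j"
        then show ?thesis using * by (intro CollectI exI[of _ j]) (auto simp: insert_commute)
      qed
    qed
  qed
  moreover have "distinct ?xs"
    using inj_on_subset[OF inj_tri] by (simp add: distinct_map)
  moreover have "?xs \<noteq> []" "internal_faces {..Suc t} (strip_edges s t) (pos s) (seg s) = set ?xs"
    using assms by (auto simp: strip_internal_faces atLeast0LessThan)
  ultimately show ?thesis unfolding path_graph_def by blast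
qed

text \<open>Each vertex has height 0 or 1 and thus lies on the boundary of a half-plane contained in
  the outside.\<close>

lemma strip_outerplanar_drawing: "outerplanar_drawing {..Suc t} (strip_edges s t) (pos s) (seg s)"
  unfolding outerplanar_drawing_def
proof (intro conjI strip_planar_drawing subsetI)
  let ?D = "drawing_image {..Suc t} (strip_edges s t) (pos s) (seg s)"
  fix z assume z: "z \<in> pos s ` {..Suc t}"
  then have "z \<in> ?D" by (auto simp: drawing_image_def)
  then have "z \<notin> interior (outside ?D)"
    using outside_no_overlap[of ?D] interior_subset by blast
  moreover have "z \<in> closure (outside ?D)"
  proof -
    obtain v where "z = pos s v" using z by blast
    then have "Im z \<ge> 1 \<or> Im z \<le> 0" by (cases "side s v") (simp_all add: pos_def)
    moreover have "closure {w. 1 < Im w} = {w. 1 \<le> Im w}" "closure {w. Im w < 0} = {w. Im w \<le> 0}"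
      using closure_halfspace_gt[of \<i> 1] closure_halfspace_lt[of \<i> 0]
      by (simp_all add: inner_complex_def)
    ultimately show ?thesis
      using closure_mono[OF outside_upper[of t s]] closure_mono[OF outside_lower[of t s]] by auto
  qed
  ultimately show "z \<in> frontier (outside ?D)" by (simp add: frontier_def)
qed

subsection \<open>Maximality\<close>

text \<open>A drawing fixes only the set of the two ends of an edge; reversing the arc if necessary
  yields the desired direction.\<close>

lemma planar_drawing_edge_arc:
  assumes "planar_drawing V E p \<gamma>" "{a, b} \<in> E"
  obtains h where "arc h" "pathstart h = p a" "pathfinish h = p b" "path_image h = path_image (\<gamma> {a, b})"
proof -
  have "arc (\<gamma> {a, b})" "{pathstart (\<gamma> {a, b}), pathfinish (\<gamma> {a, b})} = {p a, p b}"
    using assms by (auto simp: planar_drawing_def)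
  then consider "pathstart (\<gamma> {a, b}) = p a" "pathfinish (\<gamma> {a, b}) = p b"
    | "pathstart (\<gamma> {a, b}) = p b" "pathfinish (\<gamma> {a, b}) = p a"
    by (auto simp: doubleton_eq_iff)
  then show thesis
  proof cases
    case 1
    then show thesis using that \<open>arc (\<gamma> {a, b})\<close> by blast
  next
    case 2
    then show thesis using that[of "reversepath (\<gamma> {a, b})"] \<open>arc (\<gamma> {a, b})\<close>
      by (simp add: arc_reversepath)
  qed
qed

lemma planar_drawing_inter:
  assumes "planar_drawing V E p \<gamma>" "e \<in> E" "f \<in> E" "e \<noteq> f"
  shows "path_image (\<gamma> e) \<inter> path_image (\<gamma> f) \<subseteq> p ` (e \<inter> f)"
  using assms unfolding planar_drawing_def by blast

text \<open>In any drawing, \<open>rung s 0\<close> and the first \<open>j\<close> rails form an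
  arc: the part of the outer cycle that is cut off by \<open>rung s j\<close>. A rail of the upper
  line is appended at its end, a rail of the lower line is put in front.\<close>

lemma strip_left_arc:
  assumes pd: "planar_drawing V E p \<gamma>" and E: "strip_edges s t \<subseteq> E" and "j \<le> t"
  shows "\<exists>g. arc g \<and> pathstart g = p (lev s False j) \<and> pathfinish g = p (lev s True j) \<and>
           p ` {..Suc j} \<subseteq> path_image g \<and>
           path_image g \<subseteq> (\<Union>e\<in>insert (rung s 0) (rail s ` {..<j}). path_image (\<gamma> e))"
  using \<open>j \<le> t\<close>
proof (induction j)
  case 0
  have "rung s 0 \<in> E"
    using E by (auto simp: strip_edges_def)
  then have "{lev s False 0, lev s True 0} \<in> E"
    unfolding rung_def .
  then obtain h where h: "arc h" "pathstart h = p (lev s False 0)" "pathfinish h = p (lev s True 0)"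
    "path_image h = path_image (\<gamma> {lev s False 0, lev s True 0})"
    using planar_drawing_edge_arc[OF pd] by blast
  have "p (lev s False 0) \<in> path_image h" "p (lev s True 0) \<in> path_image h"
    using h by (metis pathstart_in_path_image pathfinish_in_path_image)+
  moreover have "{..Suc 0} = {lev s False 0, lev s True 0}" by auto
  ultimately show ?case using h unfolding rung_def by (intro exI[of _ h]) auto
next
  case (Suc j)
  let ?B = "insert (rung s 0) (rail s ` {..<j})"
  have j: "j < t" using Suc.prems by simp
  obtain g where g: "arc g" "pathstart g = p (lev s False j)" "pathfinish g = p (lev s True j)"
    "p ` {..Suc j} \<subseteq> path_image g" "path_image g \<subseteq> (\<Union>e\<in>?B. path_image (\<gamma> e))"
    using Suc by auto
  have rE: "rail s j \<in> E" using E j by (auto simp: strip_edges_def)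
  have BE: "?B \<subseteq> E" using E j by (auto simp: strip_edges_def)
  have Bsub: "e \<subseteq> {..Suc j}" if "e \<in> ?B" for e
    using that rung_subset[of s 0] rail_subset[of s] by fastforce
  \<comment> \<open>The end \<open>j + 2\<close> of this rail is new, so the rail touches
    \<open>g\<close> only in its old end and the join is again an arc.\<close>
  have meet: "path_image g \<inter> path_image (\<gamma> (rail s j)) \<subseteq> {p (lev s (s j) j)}"
  proof
    fix z assume z: "z \<in> path_image g \<inter> path_image (\<gamma> (rail s j))"
    then obtain e where e: "e \<in> ?B" "z \<in> path_image (\<gamma> e)" using g(5) by blast
    have "e \<noteq> rail s j" using Bsub[OF e(1)] by (auto simp: rail_def)
    then have "z \<in> p ` (e \<inter> rail s j)"
      using planar_drawing_inter[OF pd, of e "rail s j"] e BE rE z by blast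
    then show "z \<in> {p (lev s (s j) j)}" using Bsub[OF e(1)] by (auto simp: rail_def)
  qed
  have newB: "insert (rung s 0) (rail s ` {..<Suc j}) = insert (rail s j) ?B"
    by (auto simp: lessThan_Suc)
  have new: "{..Suc (Suc j)} = insert (j + 2) {..Suc j}" by auto
  show ?case
  proof (cases "s j")
    case True
    obtain h where h: "arc h" "pathstart h = p (lev s True j)" "pathfinish h = p (j + 2)"
      "path_image h = path_image (\<gamma> (rail s j))"
      using planar_drawing_edge_arc[OF pd, of "lev s True j" "j + 2"] rE True unfolding rail_def by auto
    have "arc (g +++ h)" using g h meet True by (intro arc_join) auto
    moreover have "path_image (g +++ h) = path_image g \<union> path_image (\<gamma> (rail s j))"
      using g h by (simp add: path_image_join)
    moreover have "p (j + 2) \<in> path_image (\<gamma> (rail s j))"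
      using h by (metis pathfinish_in_path_image)
    ultimately show ?thesis
      unfolding newB new using g h True by (intro exI[of _ "g +++ h"]) auto
  next
    case False
    obtain h where h: "arc h" "pathstart h = p (j + 2)" "pathfinish h = p (lev s False j)"
      "path_image h = path_image (\<gamma> (rail s j))"
      using planar_drawing_edge_arc[OF pd, of "j + 2" "lev s False j"] rE False unfolding rail_def
      by (auto simp: insert_commute)
    have "arc (h +++ g)" using g h meet False by (intro arc_join) auto
    moreover have "path_image (h +++ g) = path_image g \<union> path_image (\<gamma> (rail s j))"
      using g h by (simp add: path_image_join Un_commute)
    moreover have "p (j + 2) \<in> path_image (\<gamma> (rail s j))"
      using h by (metis pathstart_in_path_image)
    ultimately show ?thesis
      unfolding newB new using g h False by (intro exI[of _ "h +++ g"]) auto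
  qed
qed

text \<open>On the line of the new vertex the edge is \<open>rail s j\<close>, to the other line it
  is \<open>rung s (Suc j)\<close>.\<close>

lemma strip_edges_new_vertex:
  assumes "j < t" shows "{lev s b j, j + 2} \<in> strip_edges s t"
proof (cases "s j = b")
  case True
  then have "{lev s b j, j + 2} = rail s j" by (simp add: rail_def)
  then show ?thesis using assms by (auto simp: strip_edges_def)
next
  case False
  then have "{lev s b j, j + 2} = rung s (Suc j)" by (cases b) (auto simp: rung_def)
  then show ?thesis using assms by (auto simp: strip_edges_def)
qed

text \<open>The branch vertices of the K4 subdivision are the ends of \<open>rung s j\<close>, the
  new vertex \<open>j + 2\<close> and \<open>u\<close>. The outer arc from
  \<open>strip_left_arc\<close> runs from one end of the rung to the other through \<open>u\<close>,
  the rung is the chord \<open>c\<close>, and the additional edge is the chord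
  \<open>d\<close>.\<close>

lemma strip_chord_not_outerplanar:
  assumes u: "u \<le> Suc j" "u \<notin> rung s j" and j: "j < t"
  shows "\<not> outerplanar {..Suc t} (insert {u, j + 2} (strip_edges s t))"
proof
  define E where "E = insert {u, j + 2} (strip_edges s t)"
  let ?x = "lev s False j" and ?y = "lev s True j" and ?v = "j + 2"
  assume "outerplanar {..Suc t} (insert {u, j + 2} (strip_edges s t))"
  then obtain p \<gamma> where pd: "planar_drawing {..Suc t} E p \<gamma>"
    and fr: "p ` {..Suc t} \<subseteq> frontier (outside (drawing_image {..Suc t} E p \<gamma>))"
    unfolding outerplanar_def outerplanar_drawing_def E_def by blast
  have inj: "inj_on p {..Suc t}" using pd by (simp add: planar_drawing_def)
  have vs: "?x \<le> Suc j" "?y \<le> Suc j" "?x \<noteq> ?y" "u \<noteq> ?x" "u \<noteq> ?y" "u \<noteq> ?v" "?x \<noteq> ?v" "?y \<noteq> ?v"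
    using u lev_le[of s False j] lev_le[of s True j] rung_ends_distinct[of s j] by (auto simp: rung_def)
  have j0: "j \<noteq> 0"
  proof
    assume "j = 0"
    then show False using u by (auto simp: rung_def)
  qed
  have SE: "strip_edges s t \<subseteq> E" by (auto simp: E_def)
  let ?B = "insert (rung s 0) (rail s ` {..<j})"
  obtain g where g: "arc g" "pathstart g = p ?x" "pathfinish g = p ?y"
    "p ` {..Suc j} \<subseteq> path_image g" "path_image g \<subseteq> (\<Union>e\<in>?B. path_image (\<gamma> e))"
    using strip_left_arc[OF pd SE, of j] j by auto
  have BE: "?B \<subseteq> E" using j by (auto simp: E_def strip_edges_def)
  have Bsub: "e \<subseteq> {..Suc j}" if "e \<in> ?B" for e
    using that rung_subset[of s 0] rail_subset[of s] by fastforce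
  \<comment> \<open>The chord \<open>c\<close> must not be one of the edges that make up
    \<open>g\<close>. For \<open>j > 0\<close> the rung contains the vertex \<open>j + 1\<close>,
    which is larger than both ends of \<open>rung s 0\<close>.\<close>
  have "rung s j \<noteq> rung s 0"
  proof -
    obtain i where i: "j = Suc i" using j0 by (cases j) auto
    have "lev s (s i) j = i + 2" unfolding i by simp
    then have "i + 2 \<in> rung s j" using lev_in_rung[of s "s i" j] by simp
    then show ?thesis using rung_subset[of s 0] by auto
  qed
  then have rB: "rung s j \<notin> ?B" using rung_neq_rail by auto
  have E4: "rung s j \<in> E" "{?x, ?v} \<in> E" "{?v, ?y} \<in> E" "{u, ?v} \<in> E"
    using strip_edges_new_vertex[OF j, of s False] strip_edges_new_vertex[OF j, of s True] j
    by (auto simp: E_def strip_edges_def insert_commute)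
  have meet: "path_image g \<inter> path_image (\<gamma> f) \<subseteq> p ` (f \<inter> {..Suc j})" if "f \<in> E" "f \<notin> ?B" for f
  proof
    fix z assume z: "z \<in> path_image g \<inter> path_image (\<gamma> f)"
    then obtain e where e: "e \<in> ?B" "z \<in> path_image (\<gamma> e)" using g(5) by blast
    then have "z \<in> p ` (e \<inter> f)"
      using planar_drawing_inter[OF pd, of e f] that BE z by blast
    then show "z \<in> p ` (f \<inter> {..Suc j})" using Bsub[OF e(1)] by blast
  qed
  have v_notin: "f \<notin> ?B" if "?v \<in> f" for f
  proof
    assume "f \<in> ?B"
    then have "?v \<in> {..Suc j}" using that Bsub by blast
    then show False by simp
  qed
  obtain h1 where h1: "arc h1" "pathstart h1 = p ?x" "pathfinish h1 = p ?v"
    and h1i: "path_image h1 = path_image (\<gamma> {?x, ?v})"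
    using planar_drawing_edge_arc[OF pd E4(2)] by blast
  obtain h2 where h2: "arc h2" "pathstart h2 = p ?v" "pathfinish h2 = p ?y"
    and h2i: "path_image h2 = path_image (\<gamma> {?v, ?y})"
    using planar_drawing_edge_arc[OF pd E4(3)] by blast
  obtain c where c: "arc c" "pathstart c = p ?x" "pathfinish c = p ?y"
    and ci: "path_image c = path_image (\<gamma> (rung s j))"
    using planar_drawing_edge_arc[OF pd E4(1)[unfolded rung_def]] unfolding rung_def by blast
  obtain d where d: "arc d" "pathstart d = p u" "pathfinish d = p ?v"
    and di: "path_image d = path_image (\<gamma> {u, ?v})"
    using planar_drawing_edge_arc[OF pd E4(4)] by blast
  note int = planar_drawing_inter[OF pd]
  have pu: "p u \<in> path_image g" "p u \<noteq> p ?x" "p u \<noteq> p ?y"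
    using g(4) u(1) vs j inj_onD[OF inj, of u] by auto
  have "\<not> {p ?x, p ?y, p u, p ?v} \<subseteq> frontier (outside (drawing_image {..Suc t} E p \<gamma>))"
  proof (rule crossing_chords_not_exposed[OF g(1-3) pu h1 h2 c d])
    show "path_image h1 \<inter> path_image h2 \<subseteq> {p ?v}"
      using int[OF E4(2,3)] vs unfolding h1i h2i by (auto simp: doubleton_eq_iff)
    show "path_image g \<inter> path_image h1 \<subseteq> {p ?x}"
      using meet[OF E4(2) v_notin] unfolding h1i by auto
    show "path_image g \<inter> path_image h2 \<subseteq> {p ?y}"
      using meet[OF E4(3) v_notin] unfolding h2i by auto
    show "path_image c \<inter> path_image g \<subseteq> {p ?x, p ?y}"
      using meet[OF E4(1) rB] unfolding ci rung_def by auto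
    show "path_image c \<inter> path_image h1 \<subseteq> {p ?x}"
      using int[OF E4(1,2)] vs unfolding ci h1i rung_def by (auto simp: doubleton_eq_iff)
    show "path_image c \<inter> path_image h2 \<subseteq> {p ?y}"
      using int[OF E4(1,3)] vs unfolding ci h2i rung_def by (auto simp: doubleton_eq_iff)
    show "path_image d \<inter> path_image g \<subseteq> {p u}"
      using meet[OF E4(4) v_notin] unfolding di by auto
    show "path_image d \<inter> path_image h1 \<subseteq> {p ?v}"
      using int[OF E4(4,2)] vs unfolding di h1i by (auto simp: doubleton_eq_iff)
    show "path_image d \<inter> path_image h2 \<subseteq> {p ?v}"
      using int[OF E4(4,3)] vs unfolding di h2i by (auto simp: doubleton_eq_iff)
    show "path_image c \<inter> path_image d = {}"
      using int[OF E4(1,4)] vs unfolding ci di rung_def by (auto simp: doubleton_eq_iff)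
    have "path_image g \<subseteq> drawing_image {..Suc t} E p \<gamma>"
      using g(5) BE unfolding drawing_image_def by blast
    moreover have "path_image (\<gamma> f) \<subseteq> drawing_image {..Suc t} E p \<gamma>" if "f \<in> E" for f
      using that unfolding drawing_image_def by blast
    ultimately show "path_image g \<union> path_image h1 \<union> path_image h2 \<union> path_image c \<union> path_image d
        \<subseteq> drawing_image {..Suc t} E p \<gamma>"
      unfolding h1i h2i ci di using E4 by (metis Un_least)
  qed
  moreover have "{?x, ?y, u, ?v} \<subseteq> {..Suc t}" using vs u j by auto
  ultimately show False using fr by blast
qed

text \<open>Since \<open>{0, 1}\<close> is \<open>rung s 0\<close>, the larger end of a missing edge
  has the form \<open>j + 2\<close>; its smaller end is not on \<open>rung s j\<close>, as
  \<open>j + 2\<close> is adjacent to both ends of that rung.\<close>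

lemma strip_maximal_outerpath:
  assumes "1 \<le> t" shows "maximal_outerpath {..Suc t} (strip_edges s t)"
proof -
  have chord: "\<not> outerplanar {..Suc t} (insert {u, v} (strip_edges s t))"
    if uv: "u < v" "v \<le> Suc t" "{u, v} \<notin> strip_edges s t" for u v
  proof -
    have "v \<noteq> 1"
    proof
      assume "v = 1"
      then have "{u, v} = rung s 0" using uv(1) by (auto simp: rung_def)
      then show False using uv(3) by (auto simp: strip_edges_def)
    qed
    then obtain j where j: "v = j + 2" using uv(1) by (metis add_2_eq_Suc' less_nat_zero_code not0_implies_Suc One_nat_def)
    have "u \<notin> rung s j"
    proof
      assume "u \<in> rung s j"
      then obtain b where "u = lev s b j" by (auto simp: rung_def)
      then show False using strip_edges_new_vertex[of j t s b] uv j by auto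
    qed
    then show ?thesis using strip_chord_not_outerplanar[of u j s t] uv j by auto
  qed
  have "\<not> outerplanar {..Suc t} (insert {u, v} (strip_edges s t))"
    if "u \<in> {..Suc t}" "v \<in> {..Suc t}" "u \<noteq> v" "{u, v} \<notin> strip_edges s t" for u v
    using chord[of u v] chord[of v u] that by (cases u v rule: linorder_cases) (auto simp: insert_commute)
  then have "maximal_outerplanar {..Suc t} (strip_edges s t)"
    using strip_simple strip_outerplanar_drawing unfolding maximal_outerplanar_def outerplanar_def by blast
  then show ?thesis
    using strip_outerplanar_drawing strip_weak_dual[OF assms] unfolding maximal_outerpath_def by blast
qed

section \<open>The sequence of fans\<close>

text \<open>This choice puts the \<open>i\<close>-th hub on the line \<open>odd i\<close> and its leaves on the opposite line.\<close>

definition fan_side :: "nat \<Rightarrow> nat \<Rightarrow> bool" where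
  "fan_side k j \<longleftrightarrow> even (Suc j div k)"

text \<open>With parameter \<open>n\<close> the strip has \<open>n + 2\<close> vertices, and for
  \<open>1 \<le> n\<close> at least one triangle; restricting it to the first \<open>n\<close>
  vertices treats small \<open>n\<close> uniformly.\<close>

definition fan_edges :: "nat \<Rightarrow> nat \<Rightarrow> nat set set" where
  "fan_edges k n = induced_edges (strip_edges (fan_side k) n) {..<n}"

text \<open>So \<open>rung (fan_side k) j\<close> joins \<open>Suc j\<close> to the current hub
  \<open>k * (j div k)\<close>. When \<open>k\<close> divides \<open>Suc j\<close>, the lines swap
  roles in the induction step: the latest vertex \<open>Suc j\<close> becomes the hub.\<close>

lemma lev_fan_side:
  "lev (fan_side k) (even (j div k)) j = Suc j \<and> lev (fan_side k) (odd (j div k)) j = k * (j div k)"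
proof (induction j)
  case (Suc j)
  show ?case
  proof (cases "k dvd Suc j")
    case True
    then have "Suc j div k = Suc (j div k)" "k * (Suc j div k) = Suc j"
      by (simp add: div_Suc mod_eq_0_iff_dvd, rule dvd_mult_div_cancel)
    then show ?thesis using Suc by (simp add: fan_side_def)
  next
    case False
    then have "Suc j div k = j div k"
      by (simp add: div_Suc mod_eq_0_iff_dvd)
    then show ?thesis using Suc by (simp add: fan_side_def)
  qed
qed auto

lemma div_mod_block:
  fixes k q r :: nat
  assumes "r < k" shows "(k * q + r) div k = q" "(k * q + r) mod k = r"
  using assms by auto

text \<open>For \<open>r \<le> k\<close> the edge is a rung. For \<open>r = Suc k\<close> it is a
  rail, because the vertex after the next hub lies on the line of the present hub.\<close>

lemma fan_hub_edge:
  assumes "0 < k" "1 \<le> r" "r \<le> Suc k" "k * i + r < n"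
  shows "{k * i, k * i + r} \<in> fan_edges k n"
proof -
  have "{k * i, k * i + r} \<in> strip_edges (fan_side k) n"
  proof (cases "r = Suc k")
    case False
    define j where "j = k * i + (r - 1)"
    have "j div k = i" unfolding j_def using assms False by (intro div_mod_block) auto
    moreover have "Suc j = k * i + r" using assms by (simp add: j_def)
    ultimately have "{k * i, k * i + r} = rung (fan_side k) j"
      using lev_fan_side[of k j] by (cases "even i") (auto simp: rung_def)
    moreover have "j \<le> n" using assms by (simp add: j_def)
    ultimately show ?thesis by (auto simp: strip_edges_def)
  next
    case True
    define j where "j = k * i + (k - 1)"
    have "j div k = i" unfolding j_def using assms by (intro div_mod_block) auto
    moreover have "Suc j = k * Suc i" using assms(1) by (simp add: j_def)
    moreover from this have "Suc j div k = Suc i" using assms(1) by (metis nonzero_mult_div_cancel_left not_less0)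
    ultimately have "lev (fan_side k) (fan_side k j) j = k * i"
      using lev_fan_side[of k j] by (simp add: fan_side_def)
    moreover have "j + 2 = k * i + r" using True assms by (simp add: j_def)
    ultimately have "{k * i, k * i + r} = rail (fan_side k) j" by (simp add: rail_def)
    moreover have "j < n" using assms True by (simp add: j_def)
    ultimately show ?thesis by (auto simp: strip_edges_def)
  qed
  then show ?thesis using assms by (auto simp: fan_edges_def induced_edges_def)
qed

text \<open>The last leaf of a block and the next hub are consecutive on the same line, so a rail
  joins them.\<close>

lemma fan_hub_predecessor_edge:
  assumes "2 \<le> k" "1 \<le> i" "k * i < n"
  shows "{k * i, k * i - 1} \<in> fan_edges k n"
proof -
  define j where "j = k * (i - 1) + (k - 2)"
  have i: "k * i = k * (i - 1) + k" using assms(2) by (cases i) auto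
  have Suc_j: "Suc j = k * (i - 1) + (k - 1)" "k * i - 1 = Suc j" using i assms(1) by (simp_all add: j_def)
  have j: "j div k = i - 1" "Suc j div k = i - 1"
    unfolding Suc_j(1) unfolding j_def using assms(1) by (intro div_mod_block; simp)+
  then have "lev (fan_side k) (fan_side k j) j = k * i - 1"
    using lev_fan_side[of k j] unfolding Suc_j(2) by (simp add: fan_side_def)
  moreover have "j + 2 = k * i" using i assms by (simp add: j_def)
  ultimately have "{k * i, k * i - 1} = rail (fan_side k) j" by (simp add: rail_def insert_commute)
  moreover have "j < n" using \<open>j + 2 = k * i\<close> assms by simp
  ultimately have "{k * i, k * i - 1} \<in> strip_edges (fan_side k) n" by (auto simp: strip_edges_def)
  then show ?thesis using assms by (auto simp: fan_edges_def induced_edges_def)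
qed

lemma fan_outerpath:
  assumes "1 \<le> n" shows "outerpath {..<n} (fan_edges k n)"
proof -
  have S: "simple_graph {..Suc n} (strip_edges (fan_side k) n)" by (rule strip_simple)
  then have "is_subgraph {..<n} (fan_edges k n) {..Suc n} (strip_edges (fan_side k) n)"
    by (auto simp: is_subgraph_def simple_graph_def fan_edges_def induced_edges_def)
  then show ?thesis
    using strip_maximal_outerpath[OF assms] unfolding outerpath_def by blast
qed

section \<open>Counting deleted vertices\<close>

lemma card_neighbours_le_max_degree:
  assumes "finite I" "h \<in> I" "N \<subseteq> I" "h \<notin> N" "\<And>x. x \<in> N \<Longrightarrow> {h, x} \<in> E"
  shows "card N \<le> max_degree I (induced_edges E I)"
proof -
  have "inj_on (\<lambda>x. {h, x}) N" by (auto simp: inj_on_def doubleton_eq_iff)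
  then have "card N = card ((\<lambda>x. {h, x}) ` N)" by (simp add: card_image)
  also have "\<dots> \<le> vertex_degree (induced_edges E I) h"
    unfolding vertex_degree_def
  proof (rule card_mono)
    show "finite {e \<in> induced_edges E I. h \<in> e}"
      using assms(1) by (rule finite_subset[rotated, OF finite_Pow_iff[THEN iffD2]]) (auto simp: induced_edges_def)
    show "(\<lambda>x. {h, x}) ` N \<subseteq> {e \<in> induced_edges E I. h \<in> e}"
      using assms by (auto simp: induced_edges_def)
  qed
  also have "\<dots> \<le> max_degree I (induced_edges E I)"
    unfolding max_degree_def using assms(1,2) by (intro Max_ge) auto
  finally show ?thesis .
qed

text \<open>If a vertex survived on either side of the intact block, these two and the
  \<open>k - 1\<close> leaves would give the hub \<open>k + 1\<close> surviving neighbours.\<close>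

lemma full_block_missing_neighbours:
  assumes k: "3 \<le> k" and i: "1 \<le> i" "k * Suc i < n"
    and I: "I \<subseteq> {..<n}" "max_degree I (induced_edges (fan_edges k n) I) \<le> k"
    and full: "{k * i..<k * Suc i} \<subseteq> I"
  shows "(k * (i - 1) \<notin> I \<and> k * i - 1 \<notin> I) \<or> (k * Suc i \<notin> I \<and> k * Suc i + 1 \<notin> I)"
proof (rule ccontr)
  assume not: "\<not> ?thesis"
  define h where "h = k * i"
  have hk: "k \<le> h" using i(1) by (simp add: h_def)
  have prev: "k * (i - 1) = h - k" by (simp add: h_def diff_mult_distrib2)
  have nxt: "k * Suc i = h + k" by (simp add: h_def)
  obtain a b where a: "a \<in> {h - k, h - 1}" "a \<in> I" and b: "b \<in> {h + k, h + k + 1}" "b \<in> I"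
    using not[unfolded nxt, folded h_def, unfolded prev] by blast
  let ?N = "{h<..<h + k} \<union> {a, b}"
  have lt: "x < n" if "x \<in> I" for x using I(1) that by auto
  have full': "{h..<h + k} \<subseteq> I" using full by (simp add: h_def add.commute)
  have fwd: "{h, h + r} \<in> fan_edges k n" if "1 \<le> r" "r \<le> Suc k" "h + r \<in> I" for r
    using fan_hub_edge[of k r i n] that lt k by (simp add: h_def)
  have edges: "{h, x} \<in> fan_edges k n" if x: "x \<in> ?N" for x
  proof -
    have "x \<in> I" using x a b full' by auto
    consider "h < x" "x \<le> h + Suc k" | "x = h - k" | "x = h - 1"
      using x a b k by auto
    then show ?thesis
    proof cases
      case 1
      then show ?thesis using fwd[of "x - h"] \<open>x \<in> I\<close> by simp
    next
      case 2
      \<comment> \<open>The edge to the previous hub is a forward edge of that hub, with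
        \<open>r = k\<close>.\<close>
      have h: "k * (i - 1) + k = h" using prev hk by simp
      have "k * (i - 1) + k < n" unfolding h using i(2) nxt by simp
      then have "{k * (i - 1), k * (i - 1) + k} \<in> fan_edges k n"
        using k by (intro fan_hub_edge) auto
      then show ?thesis unfolding h unfolding prev 2 by (simp add: insert_commute)
    next
      case 3
      then show ?thesis
        using fan_hub_predecessor_edge[of k i n] k i by (simp add: h_def)
    qed
  qed
  have "card ?N \<le> max_degree I (induced_edges (fan_edges k n) I)"
  proof (rule card_neighbours_le_max_degree[of I h])
    show "finite I" using I(1) by (rule finite_subset) simp
    show "h \<in> I" using full' k by auto
    show "?N \<subseteq> I" using full' a b by auto
    show "h \<notin> ?N" using a b hk k by auto
  qed (rule edges)
  moreover have "card ?N = (k - 1) + 2"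
  proof (subst card_Un_disjoint)
    show "{h<..<h + k} \<inter> {a, b} = {}" using a b by auto
    have "a \<noteq> b" using a b hk k by auto
    then show "card {h<..<h + k} + card {a, b} = (k - 1) + 2" by simp
  qed auto
  ultimately show False using I(2) k by simp
qed

text \<open>Each block is charged to a deleted vertex: a block that loses a vertex pays for itself, with
  its hub if the hub is deleted. A block that loses no vertex is charged to the nearest leaf of an
  adjacent block whose hub is deleted as well, so that this leaf is not used by its own block; the
  last case occurs only at the right end, where that leaf may be missing.\<close>

definition charged :: "nat \<Rightarrow> nat \<Rightarrow> nat set \<Rightarrow> nat \<Rightarrow> nat \<Rightarrow> bool" where
  "charged k n I i x \<longleftrightarrow>
     (x div k = i \<and> (x mod k = 0 \<or> k * i \<in> I)) \<or>
     (Suc (x div k) = i \<and> x mod k = k - 1 \<and> k * (x div k) \<notin> I) \<or>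
     (x div k = Suc i \<and> x mod k = 1 \<and> k * (x div k) \<notin> I) \<or>
     (x div k = Suc i \<and> x mod k = 0 \<and> Suc x = n)"

lemma charged_exists:
  assumes k: "3 \<le> k" and i: "1 \<le> i" "k * Suc i < n"
    and I: "I \<subseteq> {..<n}" "max_degree I (induced_edges (fan_edges k n) I) \<le> k"
  shows "\<exists>x. x \<in> {..<n} - I \<and> charged k n I i x"
proof (cases "{k * i..<k * Suc i} \<subseteq> I")
  case False
  then obtain y where "y \<in> {k * i..<k * Suc i}" and y: "y \<notin> I" by blast
  then have "k * i \<le> y" "y < k * Suc i" by (simp_all only: atLeastLessThan_iff)
  then have "y div k = i" by (rule div_nat_eqI)
  show ?thesis
  proof (cases "k * i \<in> I")
    case True
    then show ?thesis using y i \<open>y < k * Suc i\<close> \<open>y div k = i\<close> by (intro exI[of _ y]) (auto simp: charged_def)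
  next
    case False
    then show ?thesis using i k by (intro exI[of _ "k * i"]) (auto simp: charged_def)
  qed
next
  case True
  from full_block_missing_neighbours[OF k i I this] show ?thesis
  proof
    assume *: "k * (i - 1) \<notin> I \<and> k * i - 1 \<notin> I"
    have eq: "k * i - 1 = k * (i - 1) + (k - 1)" using i k by (cases i) auto
    have "(k * i - 1) div k = i - 1" "(k * i - 1) mod k = k - 1"
      unfolding eq using k by (intro div_mod_block; simp)+
    then show ?thesis using * i k by (intro exI[of _ "k * i - 1"]) (auto simp: charged_def)
  next
    assume *: "k * Suc i \<notin> I \<and> k * Suc i + 1 \<notin> I"
    have dm: "(k * Suc i + 1) div k = Suc i" "(k * Suc i + 1) mod k = 1"
      "(k * Suc i) div k = Suc i" "(k * Suc i) mod k = 0"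
      using div_mod_block[of 1 k "Suc i"] div_mod_block[of 0 k "Suc i"] k
      by (simp_all del: mult_Suc_right)
    show ?thesis
    proof (cases "k * Suc i + 1 < n")
      case True
      then show ?thesis using * dm by (intro exI[of _ "k * Suc i + 1"]) (auto simp: charged_def)
    next
      case False
      then have "Suc (k * Suc i) = n" using i by simp
      then show ?thesis using * dm i by (intro exI[of _ "k * Suc i"]) (auto simp: charged_def)
    qed
  qed
qed

text \<open>The block of \<open>x\<close>, its residue and the status of its hub determine the
  clause that applies; \<open>3 \<le> k\<close> keeps the residues 0, 1 and \<open>k - 1\<close>
  distinct. In the clause with \<open>Suc x = n\<close>, \<open>x\<close> lies in the last block,
  while blocks \<open>i\<close> and \<open>j\<close> are followed by another hub, so this clause
  cannot clash with the first one.\<close>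

lemma charged_unique:
  assumes k: "3 \<le> k" and "k * Suc i < n" "k * Suc j < n"
    and "charged k n I i x" "charged k n I j x"
  shows "i = j"
proof -
  obtain q r where qr: "x div k = q" "x mod k = r" by blast
  have "n \<le> k * Suc q" if "Suc x = n"
    using that qr(1) k dividend_less_times_div[of k x] by (auto simp: Suc_le_eq)
  then have "Suc x = n \<Longrightarrow> q \<noteq> i \<and> q \<noteq> j" using assms(2,3) by auto
  moreover have "k - 1 \<noteq> 0" "k - 1 \<noteq> 1" using k by auto
  ultimately show ?thesis
    using assms(4,5) unfolding charged_def qr by (elim disjE conjE) simp_all
qed

lemma deleted_vertices_lower_bound:
  assumes k: "3 \<le> k" and n: "1 \<le> n"
    and I: "I \<subseteq> {..<n}" "max_degree I (induced_edges (fan_edges k n) I) \<le> k"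
  shows "(n - 1) div k \<le> Suc (card ({..<n} - I))"
proof -
  \<comment> \<open>\<open>(n - 1) div k\<close> is the index of the last hub; the blocks
    \<open>1, ..., M\<close> have both a block before them and a hub after them. If the quotient is
    0, the subtraction truncates and the bound is trivial.\<close>
  define M where "M = (n - 1) div k - 1"
  have M: "k * Suc i < n" if "i \<in> {1..M}" for i
  proof -
    have "Suc i \<le> (n - 1) div k" using that by (auto simp: M_def)
    then have "k * Suc i \<le> k * ((n - 1) div k)" by (rule mult_le_mono2)
    also have "\<dots> \<le> n - 1" by simp
    finally show ?thesis using n by simp
  qed
  have "\<forall>i\<in>{1..M}. \<exists>x. x \<in> {..<n} - I \<and> charged k n I i x"
    using charged_exists[OF k _ M I] by auto
  then obtain f where f: "\<And>i. i \<in> {1..M} \<Longrightarrow> f i \<in> {..<n} - I \<and> charged k n I i (f i)"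
    by metis
  have "inj_on f {1..M}"
    using charged_unique[OF k M M] f by (metis inj_onI)
  then have "card {1..M} \<le> card ({..<n} - I)"
    using f by (intro card_inj_on_le[of f]) auto
  then show ?thesis by (simp add: M_def)
qed

theorem theorem1:
  fixes n k :: nat
  assumes "n \<ge> 1" and "k \<ge> 3"
  shows "\<exists>(V :: nat set) E. outerpath V E \<and> card V = n \<and>
           (\<forall>I. I \<subseteq> V \<and> max_degree I (induced_edges E I) \<le> k \<longrightarrow>
                real (card I) \<le> (real k - 1) / real k * real n + 2)"
proof (intro exI conjI allI impI)
  show "outerpath {..<n} (fan_edges k n)" using assms(1) by (rule fan_outerpath)
  show "card {..<n} = n" by simp
  fix I assume "I \<subseteq> {..<n} \<and> max_degree I (induced_edges (fan_edges k n) I) \<le> k"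
  then have I: "I \<subseteq> {..<n}" "max_degree I (induced_edges (fan_edges k n) I) \<le> k" by blast+
  \<comment> \<open>\<open>d\<close> is the index of the last hub. The additive constant 2 consists
    of 1 from the charging, \<open>d + card I \<le> n + 1\<close>, and 1 from rounding,
    \<open>n / k \<le> d + 1\<close>.\<close>
  obtain d where d: "(n - 1) div k = d" by blast
  have "card ({..<n} - I) = n - card I"
    using I(1) by (subst card_Diff_subset) (auto intro: finite_subset)
  moreover have "card I \<le> n" using card_mono[OF _ I(1)] by simp
  ultimately have del: "d + card I \<le> Suc n"
    using deleted_vertices_lower_bound[OF assms(2,1) I] unfolding d by linarith
  have "n - 1 < k + k * d"
    using dividend_less_times_div[of k "n - 1"] assms(2) unfolding d by simp
  then have "n \<le> k * (d + 1)" by simp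
  then have "real n \<le> real (k * (d + 1))" by (simp only: of_nat_le_iff)
  then have "real n / real k \<le> real d + 1"
    using assms(2) by (simp add: divide_le_eq algebra_simps)
  moreover have "(real k - 1) / real k * real n = real n - real n / real k"
    using assms(2) by (simp add: field_simps)
  moreover have "real d + real (card I) \<le> real n + 1"
    using of_nat_mono[OF del, where ?'a = real] by simp
  ultimately show "real (card I) \<le> (real k - 1) / real k * real n + 2" by linarith
qed

end
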